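(* Let $(p_{ij} \colon X_j \to X_i)_{i \sqsubseteq j \in I}$ be a projective system of topological spaces, with canonical projective limit $X, (p_i)_{i \in I}$. Let $\bullet$ be nothing, "$\leq 1$" or "$1$". If: 1. the projective system is an ep-system, 2. or $I$ has a countable cofinal subset and each $X_i$ is locally compact sober (and compact, if $\bullet$ is "$1$"), 3. or every $X_i$ is $\odot$-consonant sober (and compact, if $\bullet$ is "$1$") and every $p_{ij}$ is a proper map, then $(\mathbb P_{\mathtt{ADP}}^\bullet\, p_{ij} \colon \mathbb P_{\mathtt{ADP}}^\bullet X_j \to \mathbb P_{\mathtt{ADP}}^\bullet X_i)_{i \sqsubseteq j \in I}$ is a projective system of topological spaces, and $\mathbb P_{\mathtt{ADP}}^\bullet X, (\mathbb P_{\mathtt{ADP}}^\bullet\, p_i)_{i \in I}$ is its projective limit, up to homeomorphism.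
   Context: **Topology.** $\mathcal O X$ is the lattice of open subsets of $X$. The specialization preordering is: $x \leq y$ iff every open neighborhood of $x$ contains $y$; $\downarrow A$ denotes downward closure. A subset is saturated iff it is upwards-closed. Compactness is the open cover property, with no separation axiom. A space is locally compact iff every point has a base of compact neighborhoods; sober iff it is $T_0$ and every irreducible closed subset is the closure of a point; consonant iff for every Scott-open subset $\mathcal U$ of $\mathcal O X$ and every $U \in \mathcal U$, there is a compact saturated $Q \subseteq U$ all of whose open neighborhoods belong to $\mathcal U$; $\odot$-consonant iff for every $n \in \mathbb N$ the topological sum of $n$ copies of $X$ is consonant. A continuous map $f \colon X \to Y$ is proper iff $\downarrow f[F]$ is closed for every closed $F \subseteq X$ and $f^{-1}(Q)$ is compact saturated for every compact saturated $Q \subseteq Y$. **Projective systems.** A projective system $(p_{ij} \colon X_j \to X_i)_{i \sqsubseteq j \in I}$ consists of a directed preordered set $(I,\sqsubseteq)$, spaces $X_i$, and continuous maps $p_{ij}$ ($i \sqsubseteq j$) with $p_{ii} = \mathrm{id}$ and $p_{ij} \circ p_{jk} = p_{ik}$ for $i \sqsubseteq j \sqsubseteq k$. Its canonical projective limit is $X = \{\vec x \in \prod_{i} X_i \mid p_{ij}(x_j) = x_i \text{ for all } i \sqsubseteq j\}$ with the subspace topology of the product, $p_i$ being projection onto coordinate $i$. Saying that $Y, (q_i)_{i\in I}$ is the projective limit up to homeomorphism of a projective system with canonical limit $Z$ means that $y \mapsto (q_i(y))_{i \in I}$ is a (well-defined) homeomorphism from $Y$ onto $Z$. The system is an ep-system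 iff there are continuous maps $e_{ij} \colon X_i \to X_j$ ($i \sqsubseteq j$) with $p_{ij} \circ e_{ij} = \mathrm{id}$, $e_{ij} \circ p_{ij} \leq \mathrm{id}$ (pointwise, in the specialization preordering), $e_{ii} = \mathrm{id}$, and $e_{jk} \circ e_{ij} = e_{ik}$. **Previsions and forks.** $\overline{\mathbb R}_+ = \mathbb R_+ \cup \{\infty\}$. $\mathcal L X$ is the set of lower semicontinuous maps from $X$ to $\overline{\mathbb R}_+$ (continuous for the Scott topology on $\overline{\mathbb R}_+$), ordered pointwise. A prevision on $X$ is a Scott-continuous map $F \colon \mathcal L X \to \overline{\mathbb R}_+$ with $F(ah)=aF(h)$ for all $a \in \mathbb R_+$, $h \in \mathcal L X$. It is sublinear (resp. superlinear) iff $F(h+h') \leq F(h)+F(h')$ (resp. $\geq$) for all $h,h'$; subnormalized (resp. normalized) iff $F(\mathbf 1+h) \leq 1+F(h)$ (resp. $=$) for all $h$, where $\mathbf 1$ is the constant function $1$. A fork on $X$ is a pair $(F^-,F^+)$ of a superlinear prevision $F^-$ and a sublinear prevision $F^+$ on $X$ such that $F^-(h+h') \leq F^-(h)+F^+(h') \leq F^+(h+h')$ for all $h,h' \in \mathcal L X$. It is subnormalized (resp. normalized) iff both $F^-$ and $F^+$ are. $\mathbb P_{\mathtt{ADP}} X$, $\mathbb P_{\mathtt{ADP}}^{\leq 1} X$, $\mathbb P_{\mathtt{ADP}}^{1} X$ are the sets of forks, subnormalized forks, normalized forks on $X$, with topology generated by the sets $\{(F^-,F^+) \mid F^-(h)>r\}$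 and $\{(F^-,F^+) \mid F^+(h)>r\}$, $h \in \mathcal L X$, $r \in \mathbb R_+$. Each is an endofunctor on topological spaces; a continuous map $f \colon X \to Y$ acts by $(F^-,F^+) \mapsto (h \mapsto F^-(h \circ f),\ h \mapsto F^+(h \circ f))$, $h \in \mathcal L Y$. *)

theory Defs
  imports "HOL-Analysis.Analysis"
begin

section \<open>Specialization, saturation, sobriety\<close>

definition specializes :: "'a topology \<Rightarrow> 'a \<Rightarrow> 'a \<Rightarrow> bool" where
  "specializes X x y \<longleftrightarrow>
     x \<in> topspace X \<and> y \<in> topspace X \<and> (\<forall>U. openin X U \<and> x \<in> U \<longrightarrow> y \<in> U)"

definition downward_closure :: "'a topology \<Rightarrow> 'a set \<Rightarrow> 'a set" where
  "downward_closure X A = {x. \<exists>y\<in>A. specializes X x y}"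

definition saturatedin :: "'a topology \<Rightarrow> 'a set \<Rightarrow> bool" where
  "saturatedin X Q \<longleftrightarrow> Q \<subseteq> topspace X \<and> (\<forall>x\<in>Q. \<forall>y. specializes X x y \<longrightarrow> y \<in> Q)"

definition compact_saturated_in :: "'a topology \<Rightarrow> 'a set \<Rightarrow> bool" where
  "compact_saturated_in X Q \<longleftrightarrow> compactin X Q \<and> saturatedin X Q"

definition irreducible_closedin :: "'a topology \<Rightarrow> 'a set \<Rightarrow> bool" where
  "irreducible_closedin X C \<longleftrightarrow> closedin X C \<and> C \<noteq> {} \<and>
     (\<forall>A B. closedin X A \<and> closedin X B \<and> C \<subseteq> A \<union> B \<longrightarrow> C \<subseteq> A \<or> C \<subseteq> B)"

definition sober_space :: "'a topology \<Rightarrow> bool" where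
  "sober_space X \<longleftrightarrow> t0_space X \<and>
     (\<forall>C. irreducible_closedin X C \<longrightarrow> (\<exists>x\<in>topspace X. C = X closure_of {x}))"

text \<open>The library's \<open>locally_compact_space\<close> only asks for one compact neighbourhood of each
  point, which is weaker than the following in the absence of separation axioms.\<close>

definition strongly_locally_compact_space :: "'a topology \<Rightarrow> bool" where
  "strongly_locally_compact_space X \<longleftrightarrow> neighbourhood_base_of (compactin X) X"

text \<open>Not the library's \<open>proper_map\<close>, which asks for closedness of images (without downward
  closure) and compactness of fibres.\<close>

definition order_proper_map :: "'a topology \<Rightarrow> 'b topology \<Rightarrow> ('a \<Rightarrow> 'b) \<Rightarrow> bool" where
  "order_proper_map X Y f \<longleftrightarrow> continuous_map X Y f \<and>
     (\<forall>F. closedin X F \<longrightarrow> closedin Y (downward_closure Y (f ` F))) \<and>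
     (\<forall>Q. compact_saturated_in Y Q \<longrightarrow> compact_saturated_in X {x \<in> topspace X. f x \<in> Q})"

section \<open>Scott topologies\<close>

definition directed_set :: "'a::order set \<Rightarrow> bool" where
  "directed_set D \<longleftrightarrow> D \<noteq> {} \<and> (\<forall>x\<in>D. \<forall>y\<in>D. \<exists>z\<in>D. x \<le> z \<and> y \<le> z)"

text \<open>The Scott topology on a subset \<open>P\<close> of a complete lattice. It is the Scott topology of the
  poset \<open>P\<close> provided \<open>P\<close> is closed under directed suprema, which is the case for all the sets
  \<open>P\<close> used below: the lattice of open sets, the extended nonnegative reals, and the set of lower
  semicontinuous maps.\<close>

definition scott_open :: "'a::complete_lattice set \<Rightarrow> 'a set \<Rightarrow> bool" where
  "scott_open P U \<longleftrightarrow> U \<subseteq> P \<and>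
     (\<forall>x\<in>U. \<forall>y\<in>P. x \<le> y \<longrightarrow> y \<in> U) \<and>
     (\<forall>D. D \<subseteq> P \<and> directed_set D \<and> Sup D \<in> U \<longrightarrow> D \<inter> U \<noteq> {})"

definition scott_topology :: "'a::complete_lattice set \<Rightarrow> 'a topology" where
  "scott_topology P = topology (scott_open P)"

lemma istopology_scott_open: "istopology (scott_open P)"
  unfolding istopology_def
proof (intro conjI allI impI)
  fix S T assume S: "scott_open P S" and T: "scott_open P T"
  show "scott_open P (S \<inter> T)"
    unfolding scott_open_def
  proof (intro conjI ballI allI impI)
    show "S \<inter> T \<subseteq> P"
      using S by (auto simp: scott_open_def)
    show "y \<in> S \<inter> T" if "x \<in> S \<inter> T" "y \<in> P" "x \<le> y" for x y
      using S T that by (metis IntD1 IntD2 IntI scott_open_def)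
    fix D assume D: "D \<subseteq> P \<and> directed_set D \<and> Sup D \<in> S \<inter> T"
    have "D \<inter> S \<noteq> {}" "D \<inter> T \<noteq> {}"
      using S T D by (simp_all add: scott_open_def)
    then obtain x y where xy: "x \<in> D" "x \<in> S" "y \<in> D" "y \<in> T" by blast
    then obtain z where z: "z \<in> D" "x \<le> z" "y \<le> z"
      using D by (metis directed_set_def)
    then have "z \<in> P" using D by auto
    then have "z \<in> S" "z \<in> T"
      using S T xy z by (metis scott_open_def)+
    then show "D \<inter> (S \<inter> T) \<noteq> {}" using z by auto
  qed
next
  fix \<K> :: "'a set set" assume K: "\<forall>K\<in>\<K>. scott_open P K"
  show "scott_open P (\<Union>\<K>)"
    unfolding scott_open_def
  proof (intro conjI ballI allI impI)
    show "\<Union>\<K> \<subseteq> P"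
      using K by (auto simp: scott_open_def)
    show "y \<in> \<Union>\<K>" if "x \<in> \<Union>\<K>" "y \<in> P" "x \<le> y" for x y
      using K that by (metis UnionE UnionI scott_open_def)
    fix D assume D: "D \<subseteq> P \<and> directed_set D \<and> Sup D \<in> \<Union>\<K>"
    then obtain K where "K \<in> \<K>" "Sup D \<in> K" by auto
    moreover have "scott_open P K" using K \<open>K \<in> \<K>\<close> by simp
    ultimately have "D \<inter> K \<noteq> {}"
      using D by (simp add: scott_open_def)
    then show "D \<inter> \<Union>\<K> \<noteq> {}" using \<open>K \<in> \<K>\<close> by auto
  qed
qed

lemma openin_scott_topology: "openin (scott_topology P) = scott_open P"
  by (simp add: scott_topology_def istopology_scott_open)

lemma topspace_scott_topology [simp]: "topspace (scott_topology P) = P"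
proof -
  have "scott_open P P"
    by (simp add: scott_open_def directed_set_def Int_absorb2)
  then show ?thesis
    unfolding topspace_def openin_scott_topology by (auto simp: scott_open_def)
qed

section \<open>Consonance\<close>

definition consonant_space :: "'a topology \<Rightarrow> bool" where
  "consonant_space X \<longleftrightarrow>
     (\<forall>\<U>. openin (scott_topology {U. openin X U}) \<U> \<longrightarrow>
       (\<forall>U\<in>\<U>. \<exists>Q. compact_saturated_in X Q \<and> Q \<subseteq> U \<and> (\<forall>V. openin X V \<and> Q \<subseteq> V \<longrightarrow> V \<in> \<U>)))"

definition sum_consonant_space :: "'a topology \<Rightarrow> bool" where
  "sum_consonant_space X \<longleftrightarrow>
     (\<forall>n::nat. consonant_space (sum_topology (\<lambda>_. X) {..<n}))"

section \<open>Projective systems\<close>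

definition directed_preorder :: "'i set \<Rightarrow> ('i \<Rightarrow> 'i \<Rightarrow> bool) \<Rightarrow> bool" where
  "directed_preorder I le \<longleftrightarrow> I \<noteq> {} \<and> reflp_on I le \<and> transp_on I le \<and>
     (\<forall>i\<in>I. \<forall>j\<in>I. \<exists>k\<in>I. le i k \<and> le j k)"

text \<open>\<open>p i j\<close> is the bonding map from \<open>X j\<close> to \<open>X i\<close>.\<close>

definition projective_system ::
  "'i set \<Rightarrow> ('i \<Rightarrow> 'i \<Rightarrow> bool) \<Rightarrow> ('i \<Rightarrow> 'a topology) \<Rightarrow> ('i \<Rightarrow> 'i \<Rightarrow> 'a \<Rightarrow> 'a) \<Rightarrow> bool" where
  "projective_system I le X p \<longleftrightarrow> directed_preorder I le \<and>
     (\<forall>i\<in>I. \<forall>j\<in>I. le i j \<longrightarrow> continuous_map (X j) (X i) (p i j)) \<and>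
     (\<forall>i\<in>I. \<forall>x\<in>topspace (X i). p i i x = x) \<and>
     (\<forall>i\<in>I. \<forall>j\<in>I. \<forall>k\<in>I. le i j \<and> le j k \<longrightarrow>
        (\<forall>x\<in>topspace (X k). p i j (p j k x) = p i k x))"

definition canonical_limit ::
  "'i set \<Rightarrow> ('i \<Rightarrow> 'i \<Rightarrow> bool) \<Rightarrow> ('i \<Rightarrow> 'a topology) \<Rightarrow> ('i \<Rightarrow> 'i \<Rightarrow> 'a \<Rightarrow> 'a) \<Rightarrow> ('i \<Rightarrow> 'a) topology" where
  "canonical_limit I le X p =
     subtopology (product_topology X I)
       {x \<in> (\<Pi>\<^sub>E i\<in>I. topspace (X i)). \<forall>i\<in>I. \<forall>j\<in>I. le i j \<longrightarrow> p i j (x j) = x i}"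

definition is_projective_limit ::
  "'i set \<Rightarrow> ('i \<Rightarrow> 'i \<Rightarrow> bool) \<Rightarrow> ('i \<Rightarrow> 'a topology) \<Rightarrow> ('i \<Rightarrow> 'i \<Rightarrow> 'a \<Rightarrow> 'a) \<Rightarrow>
   'b topology \<Rightarrow> ('i \<Rightarrow> 'b \<Rightarrow> 'a) \<Rightarrow> bool" where
  "is_projective_limit I le X p Y q \<longleftrightarrow>
     homeomorphic_map Y (canonical_limit I le X p) (\<lambda>y. \<lambda>i\<in>I. q i y)"

definition ep_system ::
  "'i set \<Rightarrow> ('i \<Rightarrow> 'i \<Rightarrow> bool) \<Rightarrow> ('i \<Rightarrow> 'a topology) \<Rightarrow> ('i \<Rightarrow> 'i \<Rightarrow> 'a \<Rightarrow> 'a) \<Rightarrow> bool" where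
  "ep_system I le X p \<longleftrightarrow> projective_system I le X p \<and>
     (\<exists>e. (\<forall>i\<in>I. \<forall>j\<in>I. le i j \<longrightarrow>
             continuous_map (X i) (X j) (e i j) \<and>
             (\<forall>x\<in>topspace (X i). p i j (e i j x) = x) \<and>
             (\<forall>x\<in>topspace (X j). specializes (X j) (e i j (p i j x)) x)) \<and>
          (\<forall>i\<in>I. \<forall>x\<in>topspace (X i). e i i x = x) \<and>
          (\<forall>i\<in>I. \<forall>j\<in>I. \<forall>k\<in>I. le i j \<and> le j k \<longrightarrow>
             (\<forall>x\<in>topspace (X i). e j k (e i j x) = e i k x)))"

definition has_countable_cofinal_subset :: "'i set \<Rightarrow> ('i \<Rightarrow> 'i \<Rightarrow> bool) \<Rightarrow> bool" where
  "has_countable_cofinal_subset I le \<longleftrightarrow>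
     (\<exists>J\<subseteq>I. countable J \<and> (\<forall>i\<in>I. \<exists>j\<in>J. le i j))"

section \<open>Previsions and forks\<close>

text \<open>Each lower semicontinuous map on the carrier of \<open>X\<close> is represented by its extension by 0 to
  the whole type. With this convention, the pointwise order, suprema and sums of representatives
  are the ones of the represented maps; the constant map 1 is represented by
  \<open>indicator (topspace X)\<close>.\<close>

definition lsc_maps :: "'a topology \<Rightarrow> ('a \<Rightarrow> ennreal) set" where
  "lsc_maps X = {h. continuous_map X (scott_topology UNIV) h \<and> (\<forall>x. x \<notin> topspace X \<longrightarrow> h x = 0)}"

lemma Sup_lsc_maps:
  assumes "D \<subseteq> lsc_maps X" and "directed_set D"
  shows "Sup D \<in> lsc_maps X"
proof -
  have "continuous_map X (scott_topology UNIV) (Sup D)"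
    unfolding continuous_map
  proof (intro conjI allI impI)
    show "Sup D ` topspace X \<subseteq> topspace (scott_topology UNIV)" by simp
  next
    fix U :: "ennreal set" assume U: "openin (scott_topology UNIV) U"
    have eq: "{x \<in> topspace X. Sup D x \<in> U} = (\<Union>h\<in>D. {x \<in> topspace X. h x \<in> U})"
    proof (intro subset_antisym subsetI)
      fix x assume x: "x \<in> {x \<in> topspace X. Sup D x \<in> U}"
      have "directed_set ((\<lambda>h. h x) ` D)"
        using assms(2) unfolding directed_set_def le_fun_def by fast
      then have "(\<lambda>h. h x) ` D \<inter> U \<noteq> {}"
        using x U unfolding openin_scott_topology scott_open_def by simp
      then show "x \<in> (\<Union>h\<in>D. {x \<in> topspace X. h x \<in> U})"
        using x by blast
    next
      fix x assume "x \<in> (\<Union>h\<in>D. {x \<in> topspace X. h x \<in> U})"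
      then obtain h where h: "h \<in> D" "x \<in> topspace X" "h x \<in> U" by blast
      then have "h x \<le> Sup D x"
        by (meson Sup_upper le_funD)
      then show "x \<in> {x \<in> topspace X. Sup D x \<in> U}"
        using h U by (simp add: openin_scott_topology scott_open_def)
    qed
    show "openin X {x \<in> topspace X. Sup D x \<in> U}"
      unfolding eq using assms(1) U
      by (intro openin_Union) (auto simp: lsc_maps_def continuous_map)
  qed
  moreover have "Sup D x = 0" if "x \<notin> topspace X" for x
  proof -
    have "h x = 0" if "h \<in> D" for h
      using assms(1) that \<open>x \<notin> topspace X\<close> by (auto simp: lsc_maps_def)
    then have "(SUP h\<in>D. h x) \<le> 0"
      by (intro SUP_least) simp
    then show ?thesis by (simp only: Sup_apply le_zero_eq)
  qed
  ultimately show ?thesis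
    by (simp add: lsc_maps_def)
qed

text \<open>Functionals are \<open>extensional\<close>, so that equality of functionals is equality on
  \<open>lsc_maps X\<close>.\<close>

definition prevision :: "'a topology \<Rightarrow> (('a \<Rightarrow> ennreal) \<Rightarrow> ennreal) \<Rightarrow> bool" where
  "prevision X F \<longleftrightarrow> F \<in> extensional (lsc_maps X) \<and>
     continuous_map (scott_topology (lsc_maps X)) (scott_topology UNIV) F \<and>
     (\<forall>a::real. \<forall>h\<in>lsc_maps X. 0 \<le> a \<longrightarrow> F (\<lambda>x. ennreal a * h x) = ennreal a * F h)"

definition sublinear :: "'a topology \<Rightarrow> (('a \<Rightarrow> ennreal) \<Rightarrow> ennreal) \<Rightarrow> bool" where
  "sublinear X F \<longleftrightarrow> (\<forall>h\<in>lsc_maps X. \<forall>h'\<in>lsc_maps X. F (\<lambda>x. h x + h' x) \<le> F h + F h')"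

definition superlinear :: "'a topology \<Rightarrow> (('a \<Rightarrow> ennreal) \<Rightarrow> ennreal) \<Rightarrow> bool" where
  "superlinear X F \<longleftrightarrow> (\<forall>h\<in>lsc_maps X. \<forall>h'\<in>lsc_maps X. F (\<lambda>x. h x + h' x) \<ge> F h + F h')"

definition subnormalized :: "'a topology \<Rightarrow> (('a \<Rightarrow> ennreal) \<Rightarrow> ennreal) \<Rightarrow> bool" where
  "subnormalized X F \<longleftrightarrow>
     (\<forall>h\<in>lsc_maps X. F (\<lambda>x. indicator (topspace X) x + h x) \<le> 1 + F h)"

definition normalized :: "'a topology \<Rightarrow> (('a \<Rightarrow> ennreal) \<Rightarrow> ennreal) \<Rightarrow> bool" where
  "normalized X F \<longleftrightarrow>
     (\<forall>h\<in>lsc_maps X. F (\<lambda>x. indicator (topspace X) x + h x) = 1 + F h)"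

text \<open>The three values of the superscript in \<open>\<P>\<^sub>A\<^sub>D\<^sub>P\<close>: nothing, \<open>\<le> 1\<close>, and \<open>1\<close>.\<close>

datatype normalization = Unrestricted | Subnormalized | Normalized

fun satisfies_normalization ::
  "normalization \<Rightarrow> 'a topology \<Rightarrow> (('a \<Rightarrow> ennreal) \<Rightarrow> ennreal) \<Rightarrow> bool" where
  "satisfies_normalization Unrestricted X F = True"
| "satisfies_normalization Subnormalized X F = subnormalized X F"
| "satisfies_normalization Normalized X F = normalized X F"

type_synonym 'a functional_pair = "(('a \<Rightarrow> ennreal) \<Rightarrow> ennreal) \<times> (('a \<Rightarrow> ennreal) \<Rightarrow> ennreal)"

definition fork :: "'a topology \<Rightarrow> 'a functional_pair \<Rightarrow> bool" where
  "fork X = (\<lambda>(Fm, Fp).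
     prevision X Fm \<and> superlinear X Fm \<and> prevision X Fp \<and> sublinear X Fp \<and>
     (\<forall>h\<in>lsc_maps X. \<forall>h'\<in>lsc_maps X.
        Fm (\<lambda>x. h x + h' x) \<le> Fm h + Fp h' \<and> Fm h + Fp h' \<le> Fp (\<lambda>x. h x + h' x)))"

definition forks :: "normalization \<Rightarrow> 'a topology \<Rightarrow> 'a functional_pair set" where
  "forks b X = {(Fm, Fp). fork X (Fm, Fp) \<and>
     satisfies_normalization b X Fm \<and> satisfies_normalization b X Fp}"

text \<open>The whole set of forks has to be put in the subbase explicitly, since the carrier of
  \<open>topology_generated_by\<close> is the union of the given sets, and the zero fork belongs to none of the
  other subbasic open sets.\<close>

definition ADP :: "normalization \<Rightarrow> 'a topology \<Rightarrow> 'a functional_pair topology" where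
  "ADP b X = topology_generated_by
     ({forks b X} \<union>
      {{(Fm, Fp) \<in> forks b X. Fm h > ennreal r} | h r. h \<in> lsc_maps X \<and> 0 \<le> r} \<union>
      {{(Fm, Fp) \<in> forks b X. Fp h > ennreal r} | h r. h \<in> lsc_maps X \<and> 0 \<le> r})"

lemma topspace_ADP [simp]: "topspace (ADP b X) = forks b X"
  by (auto simp: ADP_def)

definition lsc_pullback :: "'a topology \<Rightarrow> ('a \<Rightarrow> 'b) \<Rightarrow> ('b \<Rightarrow> ennreal) \<Rightarrow> 'a \<Rightarrow> ennreal" where
  "lsc_pullback X f h = (\<lambda>x. if x \<in> topspace X then h (f x) else 0)"

lemma lsc_pullback_lsc_maps:
  assumes "continuous_map X Y f" and "h \<in> lsc_maps Y"
  shows "lsc_pullback X f h \<in> lsc_maps X"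
proof -
  have "continuous_map X (scott_topology UNIV) (h \<circ> f)"
    using assms by (auto simp: lsc_maps_def intro: continuous_map_compose)
  then have "continuous_map X (scott_topology UNIV) (lsc_pullback X f h)"
    by (rule continuous_map_eq) (simp add: lsc_pullback_def)
  then show ?thesis
    by (simp add: lsc_maps_def lsc_pullback_def)
qed

definition ADP_map ::
  "'a topology \<Rightarrow> 'b topology \<Rightarrow> ('a \<Rightarrow> 'b) \<Rightarrow> 'a functional_pair \<Rightarrow> 'b functional_pair" where
  "ADP_map X Y f = (\<lambda>(Fm, Fp).
     (\<lambda>h\<in>lsc_maps Y. Fm (lsc_pullback X f h), \<lambda>h\<in>lsc_maps Y. Fp (lsc_pullback X f h)))"

end

theory Submission
  imports Defs
begin

text \<open>
  Let \<open>Z\<close> be the canonical limit of the spaces. Every lower semicontinuous map \<open>h\<close> on \<open>Z\<close> is the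
  directed supremum of the maps \<open>cone i (lower i h)\<close>, where \<open>lower i h\<close> is the largest lower
  semicontinuous map on \<open>X i\<close> whose pullback \<open>cone i (lower i h)\<close> to \<open>Z\<close> lies below \<open>h\<close>
  (lemma \<open>Sup_cone_lower\<close>). A Scott-continuous functional on \<open>Z\<close> is therefore determined by its
  images on the spaces \<open>X i\<close>, and the comparison map from the forks on \<open>Z\<close> to the compatible
  families of forks is a topological embedding. What is at stake is surjectivity. A compatible family
  \<open>F\<close> can only come from \<open>glue F\<close>, the functional that sends \<open>h\<close> to \<open>SUP i\<in>I. F i (lower i h)\<close>,
  and one has to show that this functional is Scott-continuous and has the images \<open>F i\<close>.

  Both follow from the \<open>cover_property\<close>: if a family of maps \<open>e k\<close> on the spaces \<open>X k\<close> that
  increases along the bonding maps covers a map \<open>g\<close> on \<open>X i\<close> after everything has been pulled back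
  to \<open>Z\<close>, then \<open>F i g \<le> (SUP k\<in>I. F k (e k))\<close>. Homogeneity, sub- and superlinearity, the fork
  inequalities and the normalization conditions then pass from the stages to the limit, because the
  directed suprema above are compatible with sums and multiples (lemma \<open>glue_Sup_cone\<close>).

  It remains to see where the cover property comes from. In an ep-system, \<open>X i\<close> embeds into \<open>Z\<close> and
  the covering can be pulled back to \<open>X i\<close>. In the other two cases it comes from compactness, in the
  form of the lemma \<open>sober_thread_avoiding\<close>: in a projective system of sober spaces, let compact sets
  \<open>Q k\<close> be mapped into each other, and let open sets \<open>E k\<close> increase along the bonding maps; if no
  \<open>Q k\<close> is contained in \<open>E k\<close>, some point of \<open>Z\<close> avoids all \<open>E k\<close> and lies above all \<open>Q k\<close>. So a
  covering on the limit is a covering at some stage. For proper bonding maps, the compact sets are the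
  preimages of the sets of points above a given point of \<open>X i\<close>. For a sequence of locally compact
  spaces, they are produced by the functionals: their continuity allows shrinking open sets into
  compact sets at each step of the sequence with values kept above a given bound.
\<close>

section \<open>Lower semicontinuous maps and Scott-continuous functionals\<close>

text \<open>The set \<open>{..<Inf U}\<close> is directed with supremum \<open>Inf U\<close>. So a Scott-open \<open>U\<close> cannot
  contain its infimum, unless that set is empty, that is, unless the infimum is 0.\<close>

lemma scott_open_ennreal_iff:
  "scott_open UNIV U \<longleftrightarrow> U = {} \<or> U = UNIV \<or> (\<exists>r::ennreal. U = {r<..})"
proof
  assume U: "scott_open UNIV U"
  have up: "y \<in> U" if "x \<in> U" "x \<le> y" for x y
    using U that by (simp add: scott_open_def)
  show "U = {} \<or> U = UNIV \<or> (\<exists>r. U = {r<..})"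
  proof (cases "Inf U \<in> U")
    case True
    have "Sup {..<Inf U} = Inf U"
      by (rule Sup_lessThan)
    have "{..<Inf U} = {}"
    proof (rule ccontr)
      assume "{..<Inf U} \<noteq> {}"
      then have "directed_set {..<Inf U}"
        unfolding directed_set_def by (metis lessThan_iff linorder_linear order_refl)
      then have "{..<Inf U} \<inter> U \<noteq> {}"
        using U True \<open>Sup {..<Inf U} = Inf U\<close> by (simp add: scott_open_def)
      then show False
        by (metis Inf_lower disjoint_iff lessThan_iff not_less)
    qed
    then have "Inf U = 0"
      by (metis lessThan_iff empty_iff not_gr_zero)
    then show ?thesis
      using up True by force
  next
    case False
    have "U = {Inf U<..}"
    proof (intro subset_antisym subsetI)
      fix x assume "x \<in> U"
      then show "x \<in> {Inf U<..}"
        using False by (metis Inf_lower greaterThan_iff order_le_less)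
    next
      fix x assume "x \<in> {Inf U<..}"
      then obtain y where "y \<in> U" "y < x"
        by (auto simp: Inf_less_iff)
      then show "x \<in> U"
        using up by auto
    qed
    then show ?thesis by blast
  qed
next
  assume "U = {} \<or> U = UNIV \<or> (\<exists>r. U = {r<..})"
  moreover have "scott_open UNIV {r<..}" for r :: ennreal
    by (auto simp: scott_open_def less_Sup_iff)
  moreover have "scott_open UNIV (UNIV :: ennreal set)"
    by (auto simp: scott_open_def directed_set_def)
  ultimately show "scott_open UNIV U"
    by (auto simp: scott_open_def)
qed

lemma openin_scott_greaterThan: "openin (scott_topology UNIV) {r::ennreal<..}"
  unfolding openin_scott_topology scott_open_ennreal_iff by blast

text \<open>The convention that representatives vanish off the carrier is absorbed by the case
  \<open>r = 0\<close>: an open set is contained in the carrier.\<close>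

lemma lsc_maps_iff: "h \<in> lsc_maps X \<longleftrightarrow> (\<forall>r. openin X {x. r < h x})"
proof
  assume h: "h \<in> lsc_maps X"
  show "\<forall>r. openin X {x. r < h x}"
  proof
    fix r
    have "continuous_map X (scott_topology UNIV) h"
      using h by (simp add: lsc_maps_def)
    then have "openin X {x \<in> topspace X. h x \<in> {r<..}}"
      by (rule openin_continuous_map_preimage) (rule openin_scott_greaterThan)
    moreover have "{x \<in> topspace X. h x \<in> {r<..}} = {x. r < h x}"
      using h unfolding lsc_maps_def by fastforce
    ultimately show "openin X {x. r < h x}" by simp
  qed
next
  assume op: "\<forall>r. openin X {x. r < h x}"
  then have sub: "{x. r < h x} \<subseteq> topspace X" for r
    using openin_subset by blast
  have "h x = 0" if "x \<notin> topspace X" for x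
    using subsetD[OF sub[of 0], of x] that by (auto simp: zero_less_iff_neq_zero)
  moreover have "continuous_map X (scott_topology UNIV) h"
    unfolding continuous_map
  proof (intro conjI allI impI)
    fix U :: "ennreal set" assume "openin (scott_topology UNIV) U"
    then consider "U = {}" | "U = UNIV" | r where "U = {r<..}"
      unfolding openin_scott_topology scott_open_ennreal_iff by blast
    then show "openin X {x \<in> topspace X. h x \<in> U}"
    proof cases
      case 3
      then have "{x \<in> topspace X. h x \<in> U} = {x. r < h x}"
        using sub by auto
      then show ?thesis using op by simp
    qed auto
  qed simp
  ultimately show "h \<in> lsc_maps X"
    by (simp add: lsc_maps_def)
qed

lemma lsc_maps_openin: "h \<in> lsc_maps X \<Longrightarrow> openin X {x. r < h x}"
  by (simp add: lsc_maps_iff)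

lemma lsc_maps_outside: "h \<in> lsc_maps X \<Longrightarrow> x \<notin> topspace X \<Longrightarrow> h x = 0"
  by (simp add: lsc_maps_def)

lemma lsc_maps_mono_specializes:
  assumes "h \<in> lsc_maps X" and "specializes X x y"
  shows "h x \<le> h y"
proof (rule ccontr)
  assume "\<not> h x \<le> h y"
  then have "y \<in> {z. h y < h z}"
    using assms lsc_maps_openin[OF assms(1), of "h y"] by (auto simp: specializes_def)
  then show False by simp
qed

lemma lsc_maps_zero: "(\<lambda>_. 0) \<in> lsc_maps X"
  by (simp add: lsc_maps_iff)

lemma lsc_maps_Sup:
  assumes "H \<subseteq> lsc_maps X"
  shows "Sup H \<in> lsc_maps X"
proof -
  have "{x. r < Sup H x} = (\<Union>h\<in>H. {x. r < h x})" for r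
    by (auto simp: less_SUP_iff)
  moreover have "openin X (\<Union>h\<in>H. {x. r < h x})" for r
    using assms by (intro openin_Union) (auto simp: lsc_maps_iff)
  ultimately show ?thesis
    unfolding lsc_maps_iff by simp
qed

text \<open>Addition is continuous from below at every pair of values that are both positive; where one
  summand vanishes, the other one alone exceeds \<open>r\<close>.\<close>

lemma lsc_maps_add:
  assumes "h \<in> lsc_maps X" and "h' \<in> lsc_maps X"
  shows "(\<lambda>x. h x + h' x) \<in> lsc_maps X"
  unfolding lsc_maps_iff
proof
  fix r
  have split: "r < u \<or> r < v \<or> (\<exists>a b. a < u \<and> b < v \<and> r < a + b)" if "r < u + v" for u v :: ennreal
  proof (cases "u = 0 \<or> v = 0")
    case False
    then have ne: "{..<u} \<noteq> {}" "{..<v} \<noteq> {}"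
      by (metis empty_iff lessThan_iff not_gr_zero)+
    have sup: "(SUP a\<in>{..<w}. a) = w" for w :: ennreal
      using Sup_lessThan[of w] by simp
    have "r < (SUP a\<in>{..<u}. a + v)"
      using that by (simp add: ennreal_SUP_add_left[OF ne(1)] sup)
    then obtain a where a: "a < u" "r < a + v"
      by (auto simp: less_SUP_iff)
    have "r < (SUP b\<in>{..<v}. a + b)"
      using a ennreal_SUP_add_right[OF ne(2), of a "\<lambda>b. b"] sup[of v] by simp
    then obtain b where "b < v" "r < a + b"
      by (auto simp only: less_SUP_iff lessThan_iff)
    then show ?thesis using a by blast
  qed (use that in auto)
  show "openin X {x. r < h x + h' x}"
  proof (subst openin_subopen, intro ballI)
    fix x assume "x \<in> {x. r < h x + h' x}"
    then have "r < h x + h' x" by simp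
    then consider "r < h x" | "r < h' x" | a b where "a < h x" "b < h' x" "r < a + b"
      using split by blast
    then show "\<exists>T. openin X T \<and> x \<in> T \<and> T \<subseteq> {x. r < h x + h' x}"
    proof cases
      case 1
      then show ?thesis
        using lsc_maps_openin[OF assms(1), of r]
        by (intro exI[of _ "{x. r < h x}"]) (auto intro: less_le_trans)
    next
      case 2
      then show ?thesis
        using lsc_maps_openin[OF assms(2), of r]
        by (intro exI[of _ "{x. r < h' x}"]) (auto intro: less_le_trans)
    next
      case 3
      then show ?thesis
        using lsc_maps_openin[OF assms(1), of a] lsc_maps_openin[OF assms(2), of b]
        by (intro exI[of _ "{x. a < h x} \<inter> {x. b < h' x}"])
          (auto intro: less_le_trans add_mono less_imp_le)
    qed
  qed
qed

lemma lsc_maps_scale: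
  assumes "h \<in> lsc_maps X" and "0 \<le> a"
  shows "(\<lambda>x. ennreal a * h x) \<in> lsc_maps X"
proof (cases "a = 0")
  case False
  then have a: "0 < a" using assms by simp
  have "r < ennreal a * t \<longleftrightarrow> ennreal (1/a) * r < t" for r t
  proof -
    have 1: "ennreal (1/a) * (ennreal a * s) = s" "ennreal a * (ennreal (1/a) * s) = s" for s
      using a by (simp_all flip: mult.assoc ennreal_mult)
    have "ennreal c * s < ennreal c * s'" if "s < s'" "0 < c" for s s' :: ennreal and c :: real
      using that by (intro ennreal_mult_strict_left_mono) auto
    then show ?thesis
      using a 1 by (metis zero_less_divide_1_iff)
  qed
  then show ?thesis
    using assms by (simp add: lsc_maps_iff)
qed (simp add: lsc_maps_iff)

lemma lsc_maps_step:
  assumes "openin X U"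
  shows "(\<lambda>x. if x \<in> U then r else 0) \<in> lsc_maps X"
proof -
  have "{x. s < (if x \<in> U then r else 0)} = (if s < r then U else {})" for s
    by auto
  then show ?thesis using assms by (simp add: lsc_maps_iff)
qed

lemma lsc_maps_indicator: "(indicator (topspace X) :: 'a \<Rightarrow> ennreal) \<in> lsc_maps X"
proof -
  have "(indicator (topspace X) :: 'a \<Rightarrow> ennreal) = (\<lambda>x. if x \<in> topspace X then 1 else 0)"
    by (auto simp: indicator_def)
  then show ?thesis
    using lsc_maps_step[of X "topspace X" 1] by simp
qed

definition preserves_directed_Sup ::
  "'a topology \<Rightarrow> (('a \<Rightarrow> ennreal) \<Rightarrow> ennreal) \<Rightarrow> bool" where
  "preserves_directed_Sup X F \<longleftrightarrow>
     (\<forall>D\<subseteq>lsc_maps X. directed_set D \<longrightarrow> F (Sup D) = (SUP h\<in>D. F h))"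

lemma preserves_directed_SupD:
  assumes "preserves_directed_Sup X F" "D \<subseteq> lsc_maps X" "directed_set D"
  shows "F (Sup D) = (SUP h\<in>D. F h)"
  using assms by (simp add: preserves_directed_Sup_def)

lemma preserves_directed_Sup_mono:
  assumes "preserves_directed_Sup X F" and "h \<in> lsc_maps X" "h' \<in> lsc_maps X" "h \<le> h'"
  shows "F h \<le> F h'"
proof -
  have "directed_set {h, h'}" "Sup {h, h'} = h'"
    using assms(4) by (auto simp: directed_set_def sup_absorb2)
  then have "F h' = (SUP k\<in>{h, h'}. F k)"
    using assms preserves_directed_SupD[OF assms(1), of "{h, h'}"] by simp
  then show ?thesis
    by (metis SUP_upper insertI1)
qed

text \<open>A Scott-continuous \<open>F\<close> is monotone because the sets \<open>{h. r < F h}\<close> are upper sets, and it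
  cannot exceed a directed supremum of values because these sets are inaccessible by directed
  suprema. The condition on suprema gives monotonicity back through the directed sets
  \<open>{h, h'}\<close> with \<open>h \<le> h'\<close>.\<close>

lemma continuous_map_scott_iff_preserves_directed_Sup:
  "continuous_map (scott_topology (lsc_maps X)) (scott_topology UNIV) F \<longleftrightarrow>
     preserves_directed_Sup X F"
proof
  assume F: "continuous_map (scott_topology (lsc_maps X)) (scott_topology UNIV) F"
  have op: "scott_open (lsc_maps X) {h \<in> lsc_maps X. r < F h}" for r
  proof -
    have "openin (scott_topology (lsc_maps X))
        {h \<in> topspace (scott_topology (lsc_maps X)). F h \<in> {r<..}}"
      using F openin_scott_greaterThan by (rule openin_continuous_map_preimage)
    then show ?thesis by (simp add: openin_scott_topology)
  qed
  have mono: "F h \<le> F h'" if "h \<in> lsc_maps X" "h' \<in> lsc_maps X" "h \<le> h'" for h h'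
  proof (rule ccontr)
    assume "\<not> F h \<le> F h'"
    then show False
      using op[of "F h'"] that unfolding scott_open_def by force
  qed
  show "preserves_directed_Sup X F"
    unfolding preserves_directed_Sup_def
  proof (intro allI impI)
    fix D assume D: "D \<subseteq> lsc_maps X" "directed_set D"
    have S: "Sup D \<in> lsc_maps X" using D(1) by (rule lsc_maps_Sup)
    show "F (Sup D) = (SUP h\<in>D. F h)"
    proof (rule antisym)
      show "(SUP h\<in>D. F h) \<le> F (Sup D)"
        using D S by (intro SUP_least mono) (auto intro: Sup_upper)
      show "F (Sup D) \<le> (SUP h\<in>D. F h)"
      proof (rule ccontr)
        let ?r = "SUP h\<in>D. F h"
        assume "\<not> F (Sup D) \<le> ?r"
        then have "Sup D \<in> {h \<in> lsc_maps X. ?r < F h}"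
          using S by simp
        then have "D \<inter> {h \<in> lsc_maps X. ?r < F h} \<noteq> {}"
          using op[of ?r] D unfolding scott_open_def by blast
        then show False
          using SUP_upper[of _ D F] by (auto simp: not_le[symmetric])
      qed
    qed
  qed
next
  assume F: "preserves_directed_Sup X F"
  show "continuous_map (scott_topology (lsc_maps X)) (scott_topology UNIV) F"
    unfolding continuous_map
  proof (intro conjI allI impI)
    fix U :: "ennreal set" assume "openin (scott_topology UNIV) U"
    then consider "U = {}" | "U = UNIV" | r where "U = {r<..}"
      unfolding openin_scott_topology scott_open_ennreal_iff by blast
    then show "openin (scott_topology (lsc_maps X))
        {h \<in> topspace (scott_topology (lsc_maps X)). F h \<in> U}"
    proof cases
      case 2
      then show ?thesis
        using openin_topspace[of "scott_topology (lsc_maps X)"] by simp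
    next
      case 3
      have "scott_open (lsc_maps X) {h \<in> lsc_maps X. r < F h}"
        unfolding scott_open_def
      proof (intro conjI ballI allI impI)
        fix h h' assume "h \<in> {h \<in> lsc_maps X. r < F h}" "h' \<in> lsc_maps X" "h \<le> h'"
        then show "h' \<in> {h \<in> lsc_maps X. r < F h}"
          using preserves_directed_Sup_mono[OF F] by (auto intro: less_le_trans)
      next
        fix D assume "D \<subseteq> lsc_maps X \<and> directed_set D \<and> Sup D \<in> {h \<in> lsc_maps X. r < F h}"
        then show "D \<inter> {h \<in> lsc_maps X. r < F h} \<noteq> {}"
          using preserves_directed_SupD[OF F, of D] by (auto simp: less_SUP_iff)
      qed auto
      then show ?thesis using 3 by (simp add: openin_scott_topology)
    qed simp
  qed simp
qed

section \<open>Pulling back along continuous maps\<close>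

lemma lsc_pullback_apply: "x \<in> topspace X \<Longrightarrow> lsc_pullback X f h x = h (f x)"
  by (simp add: lsc_pullback_def)

lemma lsc_pullback_le_iff:
  "lsc_pullback X f h \<le> k \<longleftrightarrow> (\<forall>x\<in>topspace X. h (f x) \<le> k x)"
  by (auto simp: lsc_pullback_def le_fun_def)

lemma lsc_pullback_mono: "h \<le> h' \<Longrightarrow> lsc_pullback X f h \<le> lsc_pullback X f h'"
  by (simp add: lsc_pullback_def le_fun_def)

lemma lsc_pullback_Sup: "lsc_pullback X f (Sup D) = (SUP h\<in>D. lsc_pullback X f h)"
proof
  fix x
  have "(SUP h\<in>D. (0::ennreal)) = 0"
    by (simp add: SUP_eq_const bot_ennreal[symmetric])
  then show "lsc_pullback X f (Sup D) x = (SUP h\<in>D. lsc_pullback X f h) x"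
    by (simp add: lsc_pullback_def image_image)
qed

lemma lsc_pullback_add:
  "lsc_pullback X f (\<lambda>x. h x + h' x) = (\<lambda>x. lsc_pullback X f h x + lsc_pullback X f h' x)"
  by (auto simp: lsc_pullback_def)

lemma lsc_pullback_scale:
  "lsc_pullback X f (\<lambda>x. c * h x) = (\<lambda>x. c * lsc_pullback X f h x)"
  by (auto simp: lsc_pullback_def)

lemma lsc_pullback_indicator:
  assumes "continuous_map X Y f"
  shows "lsc_pullback X f (indicator (topspace Y)) = indicator (topspace X)"
  using continuous_map_image_subset_topspace[OF assms]
  by (force simp: lsc_pullback_def indicator_def fun_eq_iff)

lemma lsc_pullback_compose:
  assumes "continuous_map X Y f"
  shows "lsc_pullback X f (lsc_pullback Y g h) = lsc_pullback X (\<lambda>x. g (f x)) h"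
  using continuous_map_image_subset_topspace[OF assms]
  by (force simp: lsc_pullback_def fun_eq_iff)

lemma lsc_pullback_cong:
  assumes "\<And>x. x \<in> topspace X \<Longrightarrow> f x = g x"
  shows "lsc_pullback X f h = lsc_pullback X g h"
  using assms by (auto simp: lsc_pullback_def)

lemma directed_set_lsc_pullback:
  "directed_set D \<Longrightarrow> directed_set (lsc_pullback X f ` D)"
  unfolding directed_set_def by (blast intro: lsc_pullback_mono)

section \<open>Forks and continuous maps\<close>

text \<open>The shape shared by the two components of \<open>ADP_map\<close>.\<close>

definition push_functional ::
  "'a topology \<Rightarrow> 'b topology \<Rightarrow> ('a \<Rightarrow> 'b) \<Rightarrow> (('a \<Rightarrow> ennreal) \<Rightarrow> ennreal) \<Rightarrow>
   ('b \<Rightarrow> ennreal) \<Rightarrow> ennreal" where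
  "push_functional X Y f F = (\<lambda>h\<in>lsc_maps Y. F (lsc_pullback X f h))"

lemma ADP_map_eq:
  "ADP_map X Y f P = (push_functional X Y f (fst P), push_functional X Y f (snd P))"
  by (simp add: ADP_map_def push_functional_def case_prod_unfold)

lemma push_functional_apply:
  "h \<in> lsc_maps Y \<Longrightarrow> push_functional X Y f F h = F (lsc_pullback X f h)"
  by (simp add: push_functional_def)

lemma preserves_directed_Sup_push:
  assumes f: "continuous_map X Y f" and F: "preserves_directed_Sup X F"
  shows "preserves_directed_Sup Y (push_functional X Y f F)"
  unfolding preserves_directed_Sup_def
proof (intro allI impI)
  fix D assume D: "D \<subseteq> lsc_maps Y" "directed_set D"
  have "F (Sup (lsc_pullback X f ` D)) = (SUP k\<in>lsc_pullback X f ` D. F k)"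
    using D by (intro preserves_directed_SupD[OF F] directed_set_lsc_pullback)
      (auto intro: lsc_pullback_lsc_maps[OF f])
  also have "\<dots> = (SUP h\<in>D. push_functional X Y f F h)"
    unfolding image_image using D(1)
    by (intro SUP_cong) (auto simp: push_functional_apply)
  finally show "push_functional X Y f F (Sup D) = (SUP h\<in>D. push_functional X Y f F h)"
    using lsc_maps_Sup[OF D(1)] by (simp add: push_functional_apply lsc_pullback_Sup)
qed

lemma prevision_iff:
  "prevision X F \<longleftrightarrow> F \<in> extensional (lsc_maps X) \<and> preserves_directed_Sup X F \<and>
     (\<forall>a::real. \<forall>h\<in>lsc_maps X. 0 \<le> a \<longrightarrow> F (\<lambda>x. ennreal a * h x) = ennreal a * F h)"
  by (simp add: prevision_def continuous_map_scott_iff_preserves_directed_Sup)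

lemma prevision_push:
  assumes f: "continuous_map X Y f" and F: "prevision X F"
  shows "prevision Y (push_functional X Y f F)"
proof -
  have "push_functional X Y f F \<in> extensional (lsc_maps Y)"
    by (simp add: push_functional_def)
  moreover have "preserves_directed_Sup Y (push_functional X Y f F)"
    using f F by (simp add: prevision_iff preserves_directed_Sup_push)
  ultimately show ?thesis
    using F lsc_pullback_lsc_maps[OF f]
    by (simp add: prevision_iff push_functional_apply lsc_maps_scale lsc_pullback_scale)
qed

lemma satisfies_normalization_push:
  assumes f: "continuous_map X Y f" and F: "satisfies_normalization b X F"
  shows "satisfies_normalization b Y (push_functional X Y f F)"
  using F lsc_pullback_lsc_maps[OF f]
  by (cases b) (simp_all add: subnormalized_def normalized_def push_functional_apply lsc_maps_add
      lsc_maps_indicator lsc_pullback_add lsc_pullback_indicator[OF f])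

lemma forks_iff:
  "P \<in> forks b X \<longleftrightarrow>
     prevision X (fst P) \<and> superlinear X (fst P) \<and> prevision X (snd P) \<and> sublinear X (snd P) \<and>
     (\<forall>h\<in>lsc_maps X. \<forall>h'\<in>lsc_maps X.
        fst P (\<lambda>x. h x + h' x) \<le> fst P h + snd P h' \<and>
        fst P h + snd P h' \<le> snd P (\<lambda>x. h x + h' x)) \<and>
     satisfies_normalization b X (fst P) \<and> satisfies_normalization b X (snd P)"
  by (auto simp: forks_def fork_def case_prod_unfold)

lemma ADP_map_forks:
  assumes f: "continuous_map X Y f" and P: "P \<in> forks b X"
  shows "ADP_map X Y f P \<in> forks b Y"
  using P lsc_pullback_lsc_maps[OF f]
  by (simp add: forks_iff ADP_map_eq prevision_push[OF f] satisfies_normalization_push[OF f]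
      superlinear_def sublinear_def push_functional_apply lsc_maps_add lsc_pullback_add)

lemma openin_ADP_fst:
  assumes "h \<in> lsc_maps X" "0 \<le> r"
  shows "openin (ADP b X) {P \<in> forks b X. ennreal r < fst P h}"
proof -
  have "{P \<in> forks b X. ennreal r < fst P h} = {(Fm, Fp) \<in> forks b X. Fm h > ennreal r}"
    by auto
  then show ?thesis
    unfolding ADP_def using assms by (intro topology_generated_by_Basis) blast
qed

lemma openin_ADP_snd:
  assumes "h \<in> lsc_maps X" "0 \<le> r"
  shows "openin (ADP b X) {P \<in> forks b X. ennreal r < snd P h}"
proof -
  have "{P \<in> forks b X. ennreal r < snd P h} = {(Fm, Fp) \<in> forks b X. Fp h > ennreal r}"
    by auto
  then show ?thesis
    unfolding ADP_def using assms by (intro topology_generated_by_Basis) blast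
qed

lemma continuous_map_into_ADP:
  assumes "\<And>t. t \<in> topspace T \<Longrightarrow> \<phi> t \<in> forks b X"
    and "\<And>h r. h \<in> lsc_maps X \<Longrightarrow> 0 \<le> r \<Longrightarrow> openin T {t \<in> topspace T. ennreal r < fst (\<phi> t) h}"
    and "\<And>h r. h \<in> lsc_maps X \<Longrightarrow> 0 \<le> r \<Longrightarrow> openin T {t \<in> topspace T. ennreal r < snd (\<phi> t) h}"
  shows "continuous_map T (ADP b X) \<phi>"
  unfolding ADP_def
proof (rule continuous_on_generated_topo)
  fix U
  assume "U \<in> {forks b X} \<union>
      {{(Fm, Fp) \<in> forks b X. Fm h > ennreal r} | h r. h \<in> lsc_maps X \<and> 0 \<le> r} \<union>
      {{(Fm, Fp) \<in> forks b X. Fp h > ennreal r} | h r. h \<in> lsc_maps X \<and> 0 \<le> r}"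
  then consider "U = forks b X"
    | h r where "h \<in> lsc_maps X" "0 \<le> r" "U = {(Fm, Fp) \<in> forks b X. Fm h > ennreal r}"
    | h r where "h \<in> lsc_maps X" "0 \<le> r" "U = {(Fm, Fp) \<in> forks b X. Fp h > ennreal r}"
    by blast
  then show "openin T (\<phi> -` U \<inter> topspace T)"
  proof cases
    case 1
    then have "\<phi> -` U \<inter> topspace T = topspace T"
      using assms(1) by auto
    then show ?thesis by simp
  next
    case 2
    then have "\<phi> -` U \<inter> topspace T = {t \<in> topspace T. ennreal r < fst (\<phi> t) h}"
      using assms(1) by (force simp: case_prod_unfold)
    then show ?thesis using assms(2) 2 by simp
  next
    case 3
    then have "\<phi> -` U \<inter> topspace T = {t \<in> topspace T. ennreal r < snd (\<phi> t) h}"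
      using assms(1) by (force simp: case_prod_unfold)
    then show ?thesis using assms(3) 3 by simp
  qed
qed (use assms(1) in auto)

lemma continuous_map_ADP_map:
  assumes f: "continuous_map X Y f"
  shows "continuous_map (ADP b X) (ADP b Y) (ADP_map X Y f)"
proof (rule continuous_map_into_ADP)
  fix h and r :: real assume h: "h \<in> lsc_maps Y" "0 \<le> r"
  show "openin (ADP b X) {P \<in> topspace (ADP b X). ennreal r < fst (ADP_map X Y f P) h}"
    using openin_ADP_fst[OF lsc_pullback_lsc_maps[OF f h(1)] h(2)] h
    by (simp add: ADP_map_eq push_functional_apply)
  show "openin (ADP b X) {P \<in> topspace (ADP b X). ennreal r < snd (ADP_map X Y f P) h}"
    using openin_ADP_snd[OF lsc_pullback_lsc_maps[OF f h(1)] h(2)] h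
    by (simp add: ADP_map_eq push_functional_apply)
qed (simp add: ADP_map_forks[OF f])

lemma push_functional_cong:
  assumes "\<And>x. x \<in> topspace X \<Longrightarrow> f x = g x"
  shows "push_functional X Y f F = push_functional X Y g F"
  unfolding push_functional_def using lsc_pullback_cong[of X f g, OF assms] by simp

lemma push_functional_id:
  assumes "F \<in> extensional (lsc_maps X)" and "\<And>x. x \<in> topspace X \<Longrightarrow> f x = x"
  shows "push_functional X X f F = F"
proof -
  have "lsc_pullback X f h = h" if "h \<in> lsc_maps X" for h
    using assms(2) lsc_maps_outside[OF that] by (auto simp: lsc_pullback_def)
  then show ?thesis
    using assms(1) by (auto simp: push_functional_def extensional_def)
qed

lemma push_functional_compose:
  assumes f: "continuous_map X Y f" and g: "continuous_map Y W g"
  shows "push_functional Y W g (push_functional X Y f F) = push_functional X W (\<lambda>x. g (f x)) F"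
  using lsc_pullback_lsc_maps[OF g] lsc_pullback_compose[OF f, of g]
  by (auto simp: push_functional_def)

lemma ADP_map_cong:
  "(\<And>x. x \<in> topspace X \<Longrightarrow> f x = g x) \<Longrightarrow> ADP_map X Y f P = ADP_map X Y g P"
  by (simp add: ADP_map_eq cong: push_functional_cong)

lemma ADP_map_id:
  assumes "P \<in> forks b X" and "\<And>x. x \<in> topspace X \<Longrightarrow> f x = x"
  shows "ADP_map X X f P = P"
  using assms by (simp add: ADP_map_eq forks_iff prevision_def push_functional_id)

lemma ADP_map_compose:
  assumes "continuous_map X Y f" and "continuous_map Y W g"
  shows "ADP_map Y W g (ADP_map X Y f P) = ADP_map X W (\<lambda>x. g (f x)) P"
  using assms by (simp add: ADP_map_eq push_functional_compose)

lemma projective_system_ADP: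
  assumes "projective_system I le X p"
  shows "projective_system I le (\<lambda>i. ADP b (X i)) (\<lambda>i j. ADP_map (X j) (X i) (p i j))"
  unfolding projective_system_def
proof (intro conjI ballI impI)
  show "directed_preorder I le"
    using assms by (simp add: projective_system_def)
next
  fix i j assume "i \<in> I" "j \<in> I" "le i j"
  then show "continuous_map (ADP b (X j)) (ADP b (X i)) (ADP_map (X j) (X i) (p i j))"
    using assms by (simp add: projective_system_def continuous_map_ADP_map)
next
  fix i P assume "i \<in> I" "P \<in> topspace (ADP b (X i))"
  then show "ADP_map (X i) (X i) (p i i) P = P"
    using assms by (auto simp: projective_system_def intro: ADP_map_id)
next
  fix i j k P
  assume ijk: "i \<in> I" "j \<in> I" "k \<in> I" "le i j \<and> le j k"
  then have "ADP_map (X j) (X i) (p i j) (ADP_map (X k) (X j) (p j k) P) =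
      ADP_map (X k) (X i) (\<lambda>x. p i j (p j k x)) P"
    using assms by (intro ADP_map_compose) (auto simp: projective_system_def)
  also have "\<dots> = ADP_map (X k) (X i) (p i k) P"
    using assms ijk by (intro ADP_map_cong) (auto simp: projective_system_def)
  finally show "ADP_map (X j) (X i) (p i j) (ADP_map (X k) (X j) (p j k) P) =
      ADP_map (X k) (X i) (p i k) P" .
qed

section \<open>Canonical projective limits\<close>

locale projective =
  fixes I :: "'i set" and le :: "'i \<Rightarrow> 'i \<Rightarrow> bool"
    and X :: "'i \<Rightarrow> 'a topology" and p :: "'i \<Rightarrow> 'i \<Rightarrow> 'a \<Rightarrow> 'a"
  assumes system: "projective_system I le X p"
begin

abbreviation Z :: "('i \<Rightarrow> 'a) topology" where
  "Z \<equiv> canonical_limit I le X p"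

abbreviation bond :: "'i \<Rightarrow> 'i \<Rightarrow> ('a \<Rightarrow> ennreal) \<Rightarrow> 'a \<Rightarrow> ennreal" where
  "bond i j \<equiv> lsc_pullback (X j) (p i j)"

abbreviation cone :: "'i \<Rightarrow> ('a \<Rightarrow> ennreal) \<Rightarrow> ('i \<Rightarrow> 'a) \<Rightarrow> ennreal" where
  "cone i \<equiv> lsc_pullback Z (\<lambda>x. x i)"

lemma index_nonempty: "I \<noteq> {}"
  and le_refl: "i \<in> I \<Longrightarrow> le i i"
  and le_trans: "\<lbrakk>le i j; le j k; i \<in> I; j \<in> I; k \<in> I\<rbrakk> \<Longrightarrow> le i k"
  and upper_bound: "\<lbrakk>i \<in> I; j \<in> I\<rbrakk> \<Longrightarrow> \<exists>k\<in>I. le i k \<and> le j k"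
  using system
  by (auto simp: projective_system_def directed_preorder_def dest: reflp_onD transp_onD)

lemma p_continuous: "\<lbrakk>le i j; i \<in> I; j \<in> I\<rbrakk> \<Longrightarrow> continuous_map (X j) (X i) (p i j)"
  and p_id: "\<lbrakk>i \<in> I; x \<in> topspace (X i)\<rbrakk> \<Longrightarrow> p i i x = x"
  and p_comp: "\<lbrakk>le i j; le j k; i \<in> I; j \<in> I; k \<in> I; y \<in> topspace (X k)\<rbrakk> \<Longrightarrow>
    p i j (p j k y) = p i k y"
  using system by (auto simp: projective_system_def)

lemma p_topspace: "\<lbrakk>le i j; i \<in> I; j \<in> I; y \<in> topspace (X j)\<rbrakk> \<Longrightarrow> p i j y \<in> topspace (X i)"
  using continuous_map_image_subset_topspace[OF p_continuous] by blast

lemma openin_preimage: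
  "\<lbrakk>le i j; i \<in> I; j \<in> I; openin (X i) U\<rbrakk> \<Longrightarrow> openin (X j) {y \<in> topspace (X j). p i j y \<in> U}"
  using p_continuous by (rule openin_continuous_map_preimage)

lemma topspace_limit:
  "x \<in> topspace Z \<longleftrightarrow> x \<in> (\<Pi>\<^sub>E i\<in>I. topspace (X i)) \<and> (\<forall>i\<in>I. \<forall>j\<in>I. le i j \<longrightarrow> p i j (x j) = x i)"
  by (auto simp: canonical_limit_def)

lemma limit_coord: "\<lbrakk>x \<in> topspace Z; i \<in> I\<rbrakk> \<Longrightarrow> x i \<in> topspace (X i)"
  by (auto simp: topspace_limit)

lemma limit_compat: "\<lbrakk>x \<in> topspace Z; le i j; i \<in> I; j \<in> I\<rbrakk> \<Longrightarrow> p i j (x j) = x i"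
  by (simp add: topspace_limit)

lemma proj_continuous: "i \<in> I \<Longrightarrow> continuous_map Z (X i) (\<lambda>x. x i)"
  unfolding canonical_limit_def
  by (intro continuous_map_from_subtopology continuous_map_product_projection)

lemma finite_upper_bound:
  assumes "finite J" "J \<subseteq> I"
  shows "\<exists>k\<in>I. \<forall>j\<in>J. le j k"
  using assms
proof (induction J rule: finite_induct)
  case empty
  then show ?case using index_nonempty by blast
next
  case (insert i J)
  then obtain k where k: "k \<in> I" "\<forall>j\<in>J. le j k" by auto
  then obtain l where "l \<in> I" "le i l" "le k l"
    using upper_bound insert.prems by blast
  then show ?case
    using k insert.prems by (metis insert_iff insert_subset le_trans subsetD)
qed

text \<open>Directedness turns finitely many coordinate conditions into one, so that the preimages of
  open sets under single projections form a base, not only a subbase.\<close>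

lemma limit_base:
  assumes "openin Z W" "x \<in> W"
  obtains i U where "i \<in> I" "openin (X i) U" "x i \<in> U" "\<And>z. z \<in> topspace Z \<Longrightarrow> z i \<in> U \<Longrightarrow> z \<in> W"
proof -
  have x: "x \<in> topspace Z"
    using assms openin_subset by blast
  obtain V where V: "openin (product_topology X I) V" "W = V \<inter> topspace Z"
    using assms(1) openin_subset[OF assms(1)]
    unfolding canonical_limit_def openin_subtopology by fastforce
  then obtain B where B: "finite {i \<in> I. B i \<noteq> topspace (X i)}"
      "\<forall>i\<in>I. openin (X i) (B i)" "x \<in> Pi\<^sub>E I B" "Pi\<^sub>E I B \<subseteq> V"
    using assms(2) unfolding openin_product_topology_alt by blast
  define J where "J = {i \<in> I. B i \<noteq> topspace (X i)}"
  obtain k where k: "k \<in> I" "\<forall>j\<in>J. le j k"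
    using finite_upper_bound[of J] B(1) by (auto simp: J_def)
  define U where "U = topspace (X k) \<inter> (\<Inter>j\<in>J. {y \<in> topspace (X k). p j k y \<in> B j})"
  have "openin (X k) U"
    unfolding U_def using B(1,2) k
    by (intro openin_Int_Inter) (auto simp: J_def intro: openin_preimage)
  moreover have "x k \<in> U"
  proof -
    have "p j k (x k) \<in> B j" if "j \<in> J" for j
      using limit_compat[OF x, of j k] k B(3) that by (auto simp: J_def PiE_iff)
    then show ?thesis
      using limit_coord[OF x k(1)] by (simp add: U_def)
  qed
  moreover have "z \<in> W" if z: "z \<in> topspace Z" "z k \<in> U" for z
  proof -
    have "z i \<in> B i" if "i \<in> I" for i
    proof (cases "i \<in> J")
      case True
      then show ?thesis
        using z k limit_compat[OF z(1), of i k] that by (auto simp: U_def)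
    next
      case False
      then show ?thesis
        using limit_coord[OF z(1) that] that by (auto simp: J_def)
    qed
    then have "z \<in> Pi\<^sub>E I B"
      using z(1) by (auto simp: topspace_limit PiE_iff)
    then show ?thesis
      using B(4) V(2) z(1) by blast
  qed
  ultimately show thesis using k(1) that by blast
qed

lemma bond_lsc: "\<lbrakk>le i j; i \<in> I; j \<in> I; h \<in> lsc_maps (X i)\<rbrakk> \<Longrightarrow> bond i j h \<in> lsc_maps (X j)"
  using p_continuous by (rule lsc_pullback_lsc_maps)

lemma cone_lsc: "\<lbrakk>i \<in> I; h \<in> lsc_maps (X i)\<rbrakk> \<Longrightarrow> cone i h \<in> lsc_maps Z"
  using proj_continuous by (rule lsc_pullback_lsc_maps)

lemma bond_bond:
  "\<lbrakk>le i j; le j k; i \<in> I; j \<in> I; k \<in> I\<rbrakk> \<Longrightarrow> bond j k (bond i j h) = bond i k h"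
  by (subst lsc_pullback_compose[OF p_continuous]) (auto intro!: lsc_pullback_cong simp: p_comp)

lemma cone_bond: "\<lbrakk>le i j; i \<in> I; j \<in> I\<rbrakk> \<Longrightarrow> cone j (bond i j h) = cone i h"
  by (subst lsc_pullback_compose[OF proj_continuous])
    (auto intro!: lsc_pullback_cong simp: limit_compat)

text \<open>An ascending family is the data from which maps on the limit are glued: its supremum on
  the limit is a directed supremum, and every lower semicontinuous map arises in this way.\<close>

definition ascending :: "('i \<Rightarrow> 'a \<Rightarrow> ennreal) \<Rightarrow> bool" where
  "ascending e \<longleftrightarrow> (\<forall>k\<in>I. e k \<in> lsc_maps (X k)) \<and>
     (\<forall>k\<in>I. \<forall>l\<in>I. le k l \<longrightarrow> bond k l (e k) \<le> e l)"

lemma ascending_lsc: "ascending e \<Longrightarrow> k \<in> I \<Longrightarrow> e k \<in> lsc_maps (X k)"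
  and ascending_le: "\<lbrakk>ascending e; le k l; k \<in> I; l \<in> I\<rbrakk> \<Longrightarrow> bond k l (e k) \<le> e l"
  by (simp_all add: ascending_def)

lemma ascending_leD:
  "\<lbrakk>ascending e; le k l; k \<in> I; l \<in> I; y \<in> topspace (X l)\<rbrakk> \<Longrightarrow> e k (p k l y) \<le> e l y"
  using ascending_le[of e k l] by (auto simp: lsc_pullback_le_iff)

lemma cone_ascending_mono:
  "\<lbrakk>ascending e; le k l; k \<in> I; l \<in> I\<rbrakk> \<Longrightarrow> cone k (e k) \<le> cone l (e l)"
  using lsc_pullback_mono[OF ascending_le, of e k l Z "\<lambda>x. x l"] by (simp add: cone_bond)

lemma directed_set_cone_ascending:
  assumes "ascending e"
  shows "directed_set ((\<lambda>k. cone k (e k)) ` I)"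
  unfolding directed_set_def
proof (intro conjI ballI)
  fix g h assume "g \<in> (\<lambda>k. cone k (e k)) ` I" "h \<in> (\<lambda>k. cone k (e k)) ` I"
  then obtain i j where "i \<in> I" "j \<in> I" "g = cone i (e i)" "h = cone j (e j)" by blast
  then show "\<exists>z\<in>(\<lambda>k. cone k (e k)) ` I. g \<le> z \<and> h \<le> z"
    using upper_bound[of i j] cone_ascending_mono[OF assms] by blast
qed (simp add: index_nonempty)

text \<open>The right adjoint of pulling back along the projection to \<open>X i\<close>. It preserves neither sums nor
  directed suprema in general; what can be computed is the supremum of its pullbacks.\<close>

definition lower :: "'i \<Rightarrow> (('i \<Rightarrow> 'a) \<Rightarrow> ennreal) \<Rightarrow> 'a \<Rightarrow> ennreal" where
  "lower i h = Sup {g \<in> lsc_maps (X i). cone i g \<le> h}"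

lemma lower_lsc: "lower i h \<in> lsc_maps (X i)"
  unfolding lower_def by (rule lsc_maps_Sup) blast

lemma cone_lower_le: "cone i (lower i h) \<le> h"
  unfolding lower_def lsc_pullback_Sup by (rule SUP_least) simp

lemma lower_greatest: "\<lbrakk>g \<in> lsc_maps (X i); cone i g \<le> h\<rbrakk> \<Longrightarrow> g \<le> lower i h"
  unfolding lower_def by (rule Sup_upper) simp

lemma lower_mono: "h \<le> h' \<Longrightarrow> lower i h \<le> lower i h'"
  using lower_greatest[OF lower_lsc] cone_lower_le order_trans by blast

lemma ascending_lower: "ascending (\<lambda>i. lower i h)"
  unfolding ascending_def
  by (auto simp: lower_lsc cone_bond cone_lower_le intro!: lower_greatest bond_lsc)

text \<open>If \<open>r < h x\<close>, then some basic open neighbourhood of \<open>x\<close>, the preimage of an open \<open>U\<close> in some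
  \<open>X i\<close>, lies in \<open>{x. r < h x}\<close>. The step map of height \<open>r\<close> on \<open>U\<close> is then below \<open>lower i h\<close>.\<close>

lemma Sup_cone_lower:
  assumes h: "h \<in> lsc_maps Z"
  shows "(SUP i\<in>I. cone i (lower i h)) = h"
proof (rule antisym)
  show "(SUP i\<in>I. cone i (lower i h)) \<le> h"
    by (rule SUP_least) (rule cone_lower_le)
  show "h \<le> (SUP i\<in>I. cone i (lower i h))"
  proof (rule le_funI)
    fix x
    show "h x \<le> (SUP i\<in>I. cone i (lower i h)) x"
    proof (rule dense_le)
      fix r assume "r < h x"
      then have x: "x \<in> {x. r < h x}" by simp
      then have xZ: "x \<in> topspace Z"
        using lsc_maps_openin[OF h, of r] openin_subset by blast
      from lsc_maps_openin[OF h, of r] x obtain i U where iU: "i \<in> I" "openin (X i) U" "x i \<in> U"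
          and sub: "\<forall>z\<in>topspace Z. z i \<in> U \<longrightarrow> r < h z"
        by (rule limit_base) auto
      let ?g = "\<lambda>y. if y \<in> U then r else 0"
      have "?g \<in> lsc_maps (X i)"
        using iU(2) by (rule lsc_maps_step)
      moreover have "cone i ?g \<le> h"
        using sub by (auto simp: lsc_pullback_le_iff less_imp_le)
      ultimately have "?g (x i) \<le> lower i h (x i)"
        by (intro le_funD[OF lower_greatest])
      then have "r \<le> cone i (lower i h) x"
        using iU(3) xZ by (simp add: lsc_pullback_apply)
      also have "\<dots> \<le> (SUP i\<in>I. cone i (lower i h)) x"
        using iU(1) by (auto intro: SUP_upper)
      finally show "r \<le> (SUP i\<in>I. cone i (lower i h)) x" .
    qed
  qed
qed

end

lemma SUP_le_SUP:
  fixes f g :: "'i \<Rightarrow> 'b::complete_lattice"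
  assumes "\<And>i. i \<in> I \<Longrightarrow> f i \<le> g i"
  shows "(SUP i\<in>I. f i) \<le> (SUP i\<in>I. g i)"
  using assms by (intro SUP_mono) blast

context projective
begin

section \<open>Gluing compatible families of functionals\<close>

definition compatible :: "('i \<Rightarrow> ('a \<Rightarrow> ennreal) \<Rightarrow> ennreal) \<Rightarrow> bool" where
  "compatible F \<longleftrightarrow> (\<forall>i\<in>I. preserves_directed_Sup (X i) (F i)) \<and>
     (\<forall>i\<in>I. \<forall>j\<in>I. le i j \<longrightarrow> (\<forall>h\<in>lsc_maps (X i). F j (bond i j h) = F i h))"

lemma compatible_Sup: "compatible F \<Longrightarrow> i \<in> I \<Longrightarrow> preserves_directed_Sup (X i) (F i)"
  and compatible_bond:
    "\<lbrakk>compatible F; le i j; i \<in> I; j \<in> I; h \<in> lsc_maps (X i)\<rbrakk> \<Longrightarrow> F j (bond i j h) = F i h"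
  by (simp_all add: compatible_def)

lemma compatible_mono:
  "\<lbrakk>compatible F; i \<in> I; h \<in> lsc_maps (X i); h' \<in> lsc_maps (X i); h \<le> h'\<rbrakk> \<Longrightarrow> F i h \<le> F i h'"
  using preserves_directed_Sup_mono[OF compatible_Sup] .

lemma compatible_ascending_mono:
  assumes F: "compatible F" and e: "ascending e" and kl: "le k l" "k \<in> I" "l \<in> I"
  shows "F k (e k) \<le> F l (e l)"
proof -
  have "F k (e k) = F l (bond k l (e k))"
    using compatible_bond[OF F kl ascending_lsc[OF e kl(2)]] by simp
  also have "\<dots> \<le> F l (e l)"
    using F e kl by (intro compatible_mono ascending_le bond_lsc ascending_lsc)
  finally show ?thesis .
qed

text \<open>The property of the system on which everything rests: an inequality that holds only on the
  limit is respected by the functionals at the stages. It is not automatic, since the projection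
  to \<open>X i\<close> need not be onto and \<open>g\<close> is not controlled by \<open>e\<close> outside its image, where the
  functionals of a compatible family have to see nothing.\<close>

definition cover_property :: bool where
  "cover_property \<longleftrightarrow> (\<forall>F e i g. compatible F \<longrightarrow> ascending e \<longrightarrow> i \<in> I \<longrightarrow> g \<in> lsc_maps (X i) \<longrightarrow>
     cone i g \<le> (SUP k\<in>I. cone k (e k)) \<longrightarrow> F i g \<le> (SUP k\<in>I. F k (e k)))"

lemma cover_propertyD:
  "\<lbrakk>cover_property; compatible F; ascending e; i \<in> I; g \<in> lsc_maps (X i);
    cone i g \<le> (SUP k\<in>I. cone k (e k))\<rbrakk> \<Longrightarrow> F i g \<le> (SUP k\<in>I. F k (e k))"
  unfolding cover_property_def by blast

text \<open>The only candidate for a functional on the limit with prescribed images \<open>F i\<close>, because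
  \<open>h\<close> is the directed supremum of the maps \<open>cone i (lower i h)\<close>.\<close>

definition glue ::
  "('i \<Rightarrow> ('a \<Rightarrow> ennreal) \<Rightarrow> ennreal) \<Rightarrow> (('i \<Rightarrow> 'a) \<Rightarrow> ennreal) \<Rightarrow> ennreal" where
  "glue F = (\<lambda>h\<in>lsc_maps Z. SUP i\<in>I. F i (lower i h))"

lemma glue_apply: "h \<in> lsc_maps Z \<Longrightarrow> glue F h = (SUP i\<in>I. F i (lower i h))"
  by (simp add: glue_def)

lemma glue_mono:
  assumes "compatible F" "h \<in> lsc_maps Z" "h' \<in> lsc_maps Z" "h \<le> h'"
  shows "glue F h \<le> glue F h'"
  using assms
  by (simp add: glue_apply) (intro SUP_le_SUP, simp add: compatible_mono lower_lsc lower_mono)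

text \<open>For a directed set \<open>D\<close>, the maps \<open>SUP d\<in>D. lower k d\<close> form an ascending family with supremum
  \<open>Sup D\<close> on the limit. The cover property compares it with the possibly larger family of the maps
  \<open>lower k (Sup D)\<close>.\<close>

lemma preserves_directed_Sup_glue:
  assumes cover: cover_property and F: "compatible F"
  shows "preserves_directed_Sup Z (glue F)"
  unfolding preserves_directed_Sup_def
proof (intro allI impI)
  fix D assume D: "D \<subseteq> lsc_maps Z" "directed_set D"
  then have S: "Sup D \<in> lsc_maps Z" by (intro lsc_maps_Sup)
  define e where "e = (\<lambda>k. SUP d\<in>D. lower k d)"
  have e: "ascending e"
    unfolding ascending_def
  proof (intro conjI ballI impI)
    fix k assume "k \<in> I"
    show "e k \<in> lsc_maps (X k)"
      unfolding e_def by (rule lsc_maps_Sup) (auto intro: lower_lsc)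
  next
    fix k l assume kl: "k \<in> I" "l \<in> I" "le k l"
    have "bond k l (e k) = (SUP d\<in>D. bond k l (lower k d))"
      by (simp add: e_def lsc_pullback_Sup image_image)
    also have "\<dots> \<le> e l"
      unfolding e_def using ascending_le[OF ascending_lower kl(3,1,2)] by (intro SUP_mono) blast
    finally show "bond k l (e k) \<le> e l" .
  qed
  have "Sup D = (SUP d\<in>D. d)"
    by simp
  also have "\<dots> = (SUP d\<in>D. SUP k\<in>I. cone k (lower k d))"
    using D(1) by (intro SUP_cong) (auto simp only: Sup_cone_lower)
  also have "\<dots> = (SUP k\<in>I. SUP d\<in>D. cone k (lower k d))"
    by (rule SUP_commute)
  also have "\<dots> = (SUP k\<in>I. cone k (e k))"
    by (simp add: e_def lsc_pullback_Sup image_image)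
  finally have sup: "Sup D = (SUP k\<in>I. cone k (e k))" .
  have Fe: "F k (e k) = (SUP d\<in>D. F k (lower k d))" if k: "k \<in> I" for k
  proof -
    have "directed_set (lower k ` D)"
      using D(2) unfolding directed_set_def by (blast intro: lower_mono)
    then have "F k (Sup (lower k ` D)) = (SUP g\<in>lower k ` D. F k g)"
      by (intro preserves_directed_SupD[OF compatible_Sup[OF F k]]) (auto intro: lower_lsc)
    then show ?thesis
      by (simp only: e_def image_image)
  qed
  show "glue F (Sup D) = (SUP h\<in>D. glue F h)"
  proof (rule antisym)
    have "glue F (Sup D) \<le> (SUP k\<in>I. F k (e k))"
      unfolding glue_apply[OF S]
      using cone_lower_le[of _ "Sup D"] sup
      by (intro SUP_least cover_propertyD[OF cover F e] lower_lsc) auto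
    also have "\<dots> = (SUP d\<in>D. SUP k\<in>I. F k (lower k d))"
      by (simp add: Fe SUP_commute[of _ I])
    also have "\<dots> = (SUP h\<in>D. glue F h)"
      using D(1) by (intro SUP_cong) (auto simp: glue_apply)
    finally show "glue F (Sup D) \<le> (SUP h\<in>D. glue F h)" .
    show "(SUP h\<in>D. glue F h) \<le> glue F (Sup D)"
      using D(1) S by (intro SUP_least glue_mono[OF F]) (auto intro: Sup_upper)
  qed
qed

text \<open>On the limit, \<open>lower j (cone i g)\<close> is dominated by \<open>g\<close> itself, that is, by the ascending family
  of the maps \<open>bond i k g\<close>, on which \<open>F\<close> is constant with value \<open>F i g\<close>.\<close>

lemma glue_cone:
  assumes cover: cover_property and F: "compatible F" and i: "i \<in> I" and g: "g \<in> lsc_maps (X i)"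
  shows "glue F (cone i g) = F i g"
proof (rule antisym)
  have c: "cone i g \<in> lsc_maps Z"
    using i g by (rule cone_lsc)
  have "F i g \<le> F i (lower i (cone i g))"
    using g by (intro compatible_mono[OF F i] lower_lsc lower_greatest) auto
  also have "\<dots> \<le> glue F (cone i g)"
    unfolding glue_apply[OF c] using i by (rule SUP_upper)
  finally show "F i g \<le> glue F (cone i g)" .
  \<comment> \<open>Stages that are not above \<open>i\<close> get the least map, which keeps the family ascending.\<close>
  define e where "e = (\<lambda>k. if le i k then bond i k g else (\<lambda>_. 0))"
  have zero: "bond k l (\<lambda>_. 0) = (\<lambda>_. 0)" for k l
    by (auto simp: lsc_pullback_def)
  have e: "ascending e"
    unfolding ascending_def
  proof (intro conjI ballI impI)
    fix k assume "k \<in> I"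
    then show "e k \<in> lsc_maps (X k)"
      using i g by (simp add: e_def bond_lsc lsc_maps_zero)
  next
    fix k l assume kl: "k \<in> I" "l \<in> I" "le k l"
    show "bond k l (e k) \<le> e l"
    proof (cases "le i k")
      case True
      then show ?thesis
        using kl i le_trans[OF True kl(3)] by (simp add: e_def bond_bond)
    next
      case False
      then show ?thesis by (simp add: e_def zero) (simp add: le_fun_def)
    qed
  qed
  have Fe: "F k (e k) \<le> F i g" if k: "k \<in> I" for k
  proof (cases "le i k")
    case True
    then show ?thesis
      using compatible_bond[OF F True i k g] by (simp add: e_def)
  next
    case False
    obtain m where m: "m \<in> I" "le i m" "le k m"
      using upper_bound[OF i k] by blast
    have "F k (e k) \<le> F m (e m)"
      using F e m(3) k m(1) by (rule compatible_ascending_mono)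
    also have "\<dots> = F i g"
      using compatible_bond[OF F m(2) i m(1) g] m(2) by (simp add: e_def)
    finally show ?thesis .
  qed
  have "F j (lower j (cone i g)) \<le> F i g" if j: "j \<in> I" for j
  proof -
    have "cone j (lower j (cone i g)) \<le> cone i g"
      by (rule cone_lower_le)
    also have "\<dots> = cone i (e i)"
      using cone_bond[OF le_refl[OF i] i i] by (simp add: e_def le_refl[OF i])
    also have "\<dots> \<le> (SUP k\<in>I. cone k (e k))"
      using i by (rule SUP_upper)
    finally have "F j (lower j (cone i g)) \<le> (SUP k\<in>I. F k (e k))"
      by (rule cover_propertyD[OF cover F e j lower_lsc])
    also have "\<dots> \<le> F i g"
      using Fe by (rule SUP_least)
    finally show ?thesis .
  qed
  then show "glue F (cone i g) \<le> F i g"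
    unfolding glue_apply[OF c] by (rule SUP_least)
qed

text \<open>Every law that relates functionals on the limit to sums and multiples of maps is inherited
  from the stages through this formula, because the family \<open>e\<close> can be formed from the families
  \<open>\<lambda>k. lower k h\<close> by the same operations.\<close>

lemma glue_Sup_cone:
  assumes cover: cover_property and F: "compatible F" and e: "ascending e"
  shows "glue F (SUP k\<in>I. cone k (e k)) = (SUP k\<in>I. F k (e k))"
proof -
  have "glue F (SUP k\<in>I. cone k (e k)) = (SUP h\<in>(\<lambda>k. cone k (e k)) ` I. glue F h)"
    using ascending_lsc[OF e] directed_set_cone_ascending[OF e]
    by (intro preserves_directed_SupD[OF preserves_directed_Sup_glue[OF cover F]])
      (auto intro: cone_lsc)
  also have "\<dots> = (SUP k\<in>I. F k (e k))"
    using ascending_lsc[OF e] by (simp add: image_image glue_cone[OF cover F])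
  finally show ?thesis .
qed

lemma SUP_add_ascending:
  fixes u v :: "'i \<Rightarrow> ennreal"
  assumes "\<And>i j. \<lbrakk>le i j; i \<in> I; j \<in> I\<rbrakk> \<Longrightarrow> u i \<le> u j"
    and "\<And>i j. \<lbrakk>le i j; i \<in> I; j \<in> I\<rbrakk> \<Longrightarrow> v i \<le> v j"
  shows "(SUP i\<in>I. u i + v i) = (SUP i\<in>I. u i) + (SUP i\<in>I. v i)"
proof (rule SUP_add_directed_ennreal)
  fix i j assume "i \<in> I" "j \<in> I"
  then show "\<exists>k\<in>I. u i + v j \<le> u k + v k"
    using upper_bound[of i j] assms by (meson add_mono)
qed

lemma ascending_add:
  assumes "ascending e" "ascending e'"
  shows "ascending (\<lambda>k x. e k x + e' k x)"
  using assms
  by (auto simp: ascending_def lsc_maps_add lsc_pullback_le_iff intro!: add_mono)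

lemma ascending_scale:
  assumes "ascending e" "0 \<le> a"
  shows "ascending (\<lambda>k x. ennreal a * e k x)"
  using assms
  by (auto simp: ascending_def lsc_maps_scale lsc_pullback_le_iff intro!: mult_left_mono)

lemma ascending_indicator: "ascending (\<lambda>k. indicator (topspace (X k)))"
  using lsc_pullback_indicator[OF p_continuous]
  by (auto simp: ascending_def lsc_maps_indicator)

lemma Sup_cone_add:
  assumes e: "ascending e" and e': "ascending e'"
  shows "(SUP k\<in>I. cone k (\<lambda>x. e k x + e' k x)) =
    (\<lambda>x. (SUP k\<in>I. cone k (e k)) x + (SUP k\<in>I. cone k (e' k)) x)"
proof
  fix x
  show "(SUP k\<in>I. cone k (\<lambda>x. e k x + e' k x)) x =
      (SUP k\<in>I. cone k (e k)) x + (SUP k\<in>I. cone k (e' k)) x"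
    unfolding lsc_pullback_add SUP_apply
    by (rule SUP_add_ascending) (simp_all add: le_funD[OF cone_ascending_mono[OF e]]
        le_funD[OF cone_ascending_mono[OF e']])
qed

lemma glue_add:
  assumes cover: cover_property and F: "compatible F"
    and h: "h \<in> lsc_maps Z" and h': "h' \<in> lsc_maps Z"
  shows "glue F (\<lambda>x. h x + h' x) = (SUP i\<in>I. F i (\<lambda>x. lower i h x + lower i h' x))"
  using glue_Sup_cone[OF cover F ascending_add[OF ascending_lower ascending_lower], of h h']
  by (simp add: Sup_cone_add ascending_lower Sup_cone_lower[OF h] Sup_cone_lower[OF h'] del: SUP_apply)

lemma add_glue:
  assumes "compatible F" "compatible G" "h \<in> lsc_maps Z" "h' \<in> lsc_maps Z"
  shows "glue F h + glue G h' = (SUP i\<in>I. F i (lower i h) + G i (lower i h'))"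
  unfolding glue_apply[OF assms(3)] glue_apply[OF assms(4)]
  by (rule SUP_add_ascending[symmetric])
    (rule compatible_ascending_mono[OF _ ascending_lower], use assms in simp_all)+

lemma glue_scale:
  assumes cover: cover_property and F: "compatible F" and h: "h \<in> lsc_maps Z" and a: "0 \<le> a"
  shows "glue F (\<lambda>x. ennreal a * h x) = (SUP i\<in>I. F i (\<lambda>x. ennreal a * lower i h x))"
proof -
  have "(SUP k\<in>I. cone k (\<lambda>x. ennreal a * lower k h x)) =
      (\<lambda>x. ennreal a * (SUP k\<in>I. cone k (lower k h)) x)"
    by (rule ext) (simp add: lsc_pullback_scale SUP_mult_left_ennreal image_image)
  then show ?thesis
    using glue_Sup_cone[OF cover F ascending_scale[OF ascending_lower a], of h]
    by (simp add: Sup_cone_lower[OF h] del: SUP_apply)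
qed

lemma glue_indicator_add:
  assumes cover: cover_property and F: "compatible F" and h: "h \<in> lsc_maps Z"
  shows "glue F (\<lambda>x. indicator (topspace Z) x + h x) =
    (SUP i\<in>I. F i (\<lambda>x. indicator (topspace (X i)) x + lower i h x))"
proof -
  have "(SUP k\<in>I. cone k (indicator (topspace (X k)))) = (SUP k\<in>I. indicator (topspace Z))"
    by (intro SUP_cong) (simp_all add: lsc_pullback_indicator proj_continuous)
  also have "\<dots> = indicator (topspace Z)"
    using index_nonempty by (rule SUP_const)
  finally show ?thesis
    using glue_Sup_cone[OF cover F ascending_add[OF ascending_indicator ascending_lower], of h]
    by (simp add: Sup_cone_add ascending_lower ascending_indicator Sup_cone_lower[OF h] del: SUP_apply)
qed

lemma prevision_glue:
  assumes cover: cover_property and F: "compatible F" and prev: "\<And>i. i \<in> I \<Longrightarrow> prevision (X i) (F i)"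
  shows "prevision Z (glue F)"
  unfolding prevision_iff
proof (intro conjI allI ballI impI)
  show "glue F \<in> extensional (lsc_maps Z)"
    by (simp add: glue_def)
  show "preserves_directed_Sup Z (glue F)"
    using cover F by (rule preserves_directed_Sup_glue)
  fix a :: real and h assume h: "h \<in> lsc_maps Z" and a: "0 \<le> a"
  have "glue F (\<lambda>x. ennreal a * h x) = (SUP i\<in>I. ennreal a * F i (lower i h))"
    unfolding glue_scale[OF cover F h a]
    using prev a by (intro SUP_cong) (auto simp: prevision_iff lower_lsc)
  then show "glue F (\<lambda>x. ennreal a * h x) = ennreal a * glue F h"
    by (simp add: glue_apply[OF h] SUP_mult_left_ennreal)
qed

lemma satisfies_normalization_glue:
  assumes cover: cover_property and F: "compatible F"
    and norm: "\<And>i. i \<in> I \<Longrightarrow> satisfies_normalization b (X i) (F i)"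
  shows "satisfies_normalization b Z (glue F)"
proof -
  have one: "1 + glue F h = (SUP i\<in>I. 1 + F i (lower i h))" if "h \<in> lsc_maps Z" for h
    using index_nonempty that by (simp add: glue_apply ennreal_SUP_add_right)
  show ?thesis
  proof (cases b)
    case Unrestricted
    then show ?thesis by simp
  next
    case Subnormalized
    then show ?thesis
      using norm by (auto simp: subnormalized_def one glue_indicator_add[OF cover F] lower_lsc
          intro!: SUP_le_SUP)
  next
    case Normalized
    then show ?thesis
      using norm by (auto simp: normalized_def one glue_indicator_add[OF cover F] lower_lsc
          intro!: SUP_cong)
  qed
qed

lemma glue_forks:
  assumes cover: cover_property
    and Fm: "compatible Fm" and Fp: "compatible Fp"
    and fk: "\<And>i. i \<in> I \<Longrightarrow> (Fm i, Fp i) \<in> forks b (X i)"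
  shows "(glue Fm, glue Fp) \<in> forks b Z"
proof -
  have "prevision Z (glue Fm)" "prevision Z (glue Fp)"
    using fk by (auto simp: forks_iff intro!: prevision_glue cover Fm Fp)
  moreover have "satisfies_normalization b Z (glue Fm)" "satisfies_normalization b Z (glue Fp)"
    using fk by (auto simp: forks_iff intro!: satisfies_normalization_glue cover Fm Fp)
  moreover have "superlinear Z (glue Fm)"
    using fk by (auto simp: superlinear_def forks_iff glue_add[OF cover Fm] add_glue[OF Fm Fm]
        lower_lsc intro!: SUP_le_SUP)
  moreover have "sublinear Z (glue Fp)"
    using fk by (auto simp: sublinear_def forks_iff glue_add[OF cover Fp] add_glue[OF Fp Fp]
        lower_lsc intro!: SUP_le_SUP)
  moreover have "glue Fm (\<lambda>x. h x + h' x) \<le> glue Fm h + glue Fp h' \<and>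
      glue Fm h + glue Fp h' \<le> glue Fp (\<lambda>x. h x + h' x)"
    if "h \<in> lsc_maps Z" "h' \<in> lsc_maps Z" for h h'
    using fk that by (auto simp: forks_iff glue_add[OF cover Fm] glue_add[OF cover Fp]
        add_glue[OF Fm Fp] lower_lsc intro!: SUP_le_SUP)
  ultimately show ?thesis
    by (simp add: forks_iff)
qed

section \<open>The projective limit of the spaces of forks\<close>

text \<open>Gluing componentwise is the inverse. It is continuous because \<open>r < glue F h\<close> means that
  \<open>r < F i (lower i h)\<close> for some \<open>i\<close>, a condition on one coordinate.\<close>

lemma is_projective_limit_ADP:
  assumes cover: cover_property
  shows "is_projective_limit I le (\<lambda>i. ADP b (X i)) (\<lambda>i j. ADP_map (X j) (X i) (p i j))
    (ADP b Z) (\<lambda>i. ADP_map Z (X i) (\<lambda>x. x i))"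
proof -
  let ?L = "canonical_limit I le (\<lambda>i. ADP b (X i)) (\<lambda>i j. ADP_map (X j) (X i) (p i j))"
  let ?\<phi> = "\<lambda>P. \<lambda>i\<in>I. ADP_map Z (X i) (\<lambda>x. x i) P"
  let ?\<psi> = "\<lambda>y. (glue (\<lambda>i. fst (y i)), glue (\<lambda>i. snd (y i)))"
  have L: "projective I le (\<lambda>i. ADP b (X i)) (\<lambda>i j. ADP_map (X j) (X i) (p i j))"
    using system by (intro projective.intro projective_system_ADP)
  have forks: "y i \<in> forks b (X i)" if "y \<in> topspace ?L" "i \<in> I" for y i
    using projective.limit_coord[OF L that] by simp
  have compat: "compatible (\<lambda>i. fst (y i))" "compatible (\<lambda>i. snd (y i))" if y: "y \<in> topspace ?L" for y
  proof -
    have "fst (y j) (bond i j h) = fst (y i) h \<and> snd (y j) (bond i j h) = snd (y i) h"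
      if "i \<in> I" "j \<in> I" "le i j" "h \<in> lsc_maps (X i)" for i j h
      unfolding projective.limit_compat[OF L y that(3,1,2), symmetric]
      using that by (simp add: ADP_map_eq push_functional_apply)
    then show "compatible (\<lambda>i. fst (y i))" "compatible (\<lambda>i. snd (y i))"
      using forks[OF y] by (auto simp: compatible_def forks_iff prevision_iff)
  qed
  have "continuous_map (ADP b Z) ?L ?\<phi>"
    unfolding canonical_limit_def[of I le "\<lambda>i. ADP b (X i)"]
  proof (intro continuous_map_into_subtopology)
    show "continuous_map (ADP b Z) (product_topology (\<lambda>i. ADP b (X i)) I) ?\<phi>"
      by (auto simp: continuous_map_componentwise continuous_map_ADP_map[OF proj_continuous])
    have "ADP_map (X j) (X i) (p i j) (ADP_map Z (X j) (\<lambda>x. x j) P) = ADP_map Z (X i) (\<lambda>x. x i) P"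
      if "i \<in> I" "j \<in> I" "le i j" for i j P
      using that by (subst ADP_map_compose[OF proj_continuous p_continuous])
        (auto intro!: ADP_map_cong simp: limit_compat)
    then show "?\<phi> \<in> topspace (ADP b Z) \<rightarrow> {x \<in> \<Pi>\<^sub>E i\<in>I. topspace (ADP b (X i)).
        \<forall>i\<in>I. \<forall>j\<in>I. le i j \<longrightarrow> ADP_map (X j) (X i) (p i j) (x j) = x i}"
      by (auto simp: ADP_map_forks[OF proj_continuous])
  qed
  moreover have "continuous_map ?L (ADP b Z) ?\<psi>"
  proof (rule continuous_map_into_ADP)
    fix y assume "y \<in> topspace ?L"
    then show "?\<psi> y \<in> forks b Z"
      using forks compat by (intro glue_forks[OF cover]) auto
  next
    fix h and r :: real assume h: "h \<in> lsc_maps Z" and r: "0 \<le> r"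
    have op: "openin ?L {y \<in> topspace ?L. y i \<in> U}" if "i \<in> I" "openin (ADP b (X i)) U" for i U
      using projective.proj_continuous[OF L that(1)] that(2) by (rule openin_continuous_map_preimage)
    have o: "openin ?L {y \<in> topspace ?L. y i \<in> {P \<in> forks b (X i). ennreal r < fst P (lower i h)}}"
      if "i \<in> I" for i
      using that openin_ADP_fst[OF lower_lsc r] by (rule op)
    have eq: "{y \<in> topspace ?L. ennreal r < fst (?\<psi> y) h} =
        (\<Union>i\<in>I. {y \<in> topspace ?L. y i \<in> {P \<in> forks b (X i). ennreal r < fst P (lower i h)}})"
      using forks by (auto simp: glue_apply[OF h] less_SUP_iff)
    show "openin ?L {y \<in> topspace ?L. ennreal r < fst (?\<psi> y) h}"
      unfolding eq by (rule openin_Union) (elim imageE, simp only: o)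
    have o: "openin ?L {y \<in> topspace ?L. y i \<in> {P \<in> forks b (X i). ennreal r < snd P (lower i h)}}"
      if "i \<in> I" for i
      using that openin_ADP_snd[OF lower_lsc r] by (rule op)
    have eq: "{y \<in> topspace ?L. ennreal r < snd (?\<psi> y) h} =
        (\<Union>i\<in>I. {y \<in> topspace ?L. y i \<in> {P \<in> forks b (X i). ennreal r < snd P (lower i h)}})"
      using forks by (auto simp: glue_apply[OF h] less_SUP_iff)
    show "openin ?L {y \<in> topspace ?L. ennreal r < snd (?\<psi> y) h}"
      unfolding eq by (rule openin_Union) (elim imageE, simp only: o)
  qed
  moreover have "?\<psi> (?\<phi> P) = P" if P: "P \<in> topspace (ADP b Z)" for P
  proof -
    have "glue (\<lambda>i. push_functional Z (X i) (\<lambda>x. x i) F) = F" if F: "prevision Z F" for F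
    proof (rule extensionalityI[of _ "lsc_maps Z"])
      fix h assume h: "h \<in> lsc_maps Z"
      have "F h = F (SUP i\<in>I. cone i (lower i h))"
        by (simp only: Sup_cone_lower[OF h])
      also have "\<dots> = (SUP k\<in>(\<lambda>i. cone i (lower i h)) ` I. F k)"
        using F by (intro preserves_directed_SupD[of Z] directed_set_cone_ascending ascending_lower)
          (auto simp: prevision_iff cone_lsc lower_lsc)
      finally show "glue (\<lambda>i. push_functional Z (X i) (\<lambda>x. x i) F) h = F h"
        by (simp add: glue_apply[OF h] image_image push_functional_apply lower_lsc)
    qed (use F in \<open>simp_all add: glue_def prevision_iff\<close>)
    moreover have "glue (\<lambda>i. fst (?\<phi> P i)) = glue (\<lambda>i. push_functional Z (X i) (\<lambda>x. x i) (fst P))"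
      "glue (\<lambda>i. snd (?\<phi> P i)) = glue (\<lambda>i. push_functional Z (X i) (\<lambda>x. x i) (snd P))"
      by (simp_all add: glue_def ADP_map_eq cong: SUP_cong)
    ultimately show ?thesis
      using P by (simp add: forks_iff)
  qed
  moreover have "?\<phi> (?\<psi> y) = y" if y: "y \<in> topspace ?L" for y
  proof (rule extensionalityI[of _ I])
    show "y \<in> extensional I"
      using y by (auto simp: projective.topspace_limit[OF L] PiE_def)
    fix i assume i: "i \<in> I"
    have "push_functional Z (X i) (\<lambda>x. x i) (glue F) = F i"
      if F: "compatible F" "F i \<in> extensional (lsc_maps (X i))" for F
      using that i by (intro extensionalityI[of _ "lsc_maps (X i)"])
        (auto simp: push_functional_def glue_cone[OF cover F(1)])
    then show "?\<phi> (?\<psi> y) i = y i"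
      using compat[OF y] forks[OF y i] i
      by (simp add: ADP_map_eq forks_iff prevision_def)
  qed simp
  ultimately show ?thesis
    unfolding is_projective_limit_def homeomorphic_map_maps homeomorphic_maps_def by blast
qed


section \<open>Covers of a single stage\<close>

text \<open>A way to the cover property: replace the maps \<open>f k\<close> by maps \<open>G k\<close> on the single space \<open>X i\<close>
  that lie below them after pulling back along the bonding maps. If the \<open>G k\<close> still cover \<open>g\<close>, now
  on all of \<open>X i\<close>, the continuity of \<open>F i\<close> suffices.\<close>

lemma bound_from_cover_at_stage:
  assumes F: "compatible F" and f: "ascending f" and i: "i \<in> I" and g: "g \<in> lsc_maps (X i)"
    and G_lsc: "\<And>k. \<lbrakk>k \<in> I; le i k\<rbrakk> \<Longrightarrow> G k \<in> lsc_maps (X i)"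
    and G_mono: "\<And>k l. \<lbrakk>k \<in> I; l \<in> I; le i k; le i l; le k l\<rbrakk> \<Longrightarrow> G k \<le> G l"
    and G_le: "\<And>k. \<lbrakk>k \<in> I; le i k\<rbrakk> \<Longrightarrow> bond i k (G k) \<le> f k"
    and cover: "g \<le> (SUP k\<in>{k \<in> I. le i k}. G k)"
  shows "F i g \<le> (SUP k\<in>I. F k (f k))"
proof -
  let ?J = "{k \<in> I. le i k}"
  have dir: "directed_set (G ` ?J)"
    unfolding directed_set_def
  proof (intro conjI ballI)
    show "G ` ?J \<noteq> {}"
      using i le_refl by auto
    fix u v assume "u \<in> G ` ?J" "v \<in> G ` ?J"
    then obtain k l where kl: "k \<in> I" "le i k" "l \<in> I" "le i l" "u = G k" "v = G l" by blast
    then obtain m where m: "m \<in> I" "le k m" "le l m"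
      using upper_bound by blast
    then have "le i m"
      using le_trans kl i by blast
    then show "\<exists>z\<in>G ` ?J. u \<le> z \<and> v \<le> z"
      using kl m G_mono by blast
  qed
  have sub: "G ` ?J \<subseteq> lsc_maps (X i)"
    using G_lsc by blast
  have "F i g \<le> F i (Sup (G ` ?J))"
    using cover by (intro compatible_mono[OF F i g] lsc_maps_Sup sub)
  also have "\<dots> = (SUP h\<in>G ` ?J. F i h)"
    by (intro preserves_directed_SupD[OF compatible_Sup[OF F i]] dir sub)
  also have "\<dots> \<le> (SUP k\<in>I. F k (f k))"
    unfolding image_image
  proof (rule SUP_least)
    fix k assume "k \<in> ?J"
    then have k: "k \<in> I" "le i k" by auto
    have "F i (G k) = F k (bond i k (G k))"
      using compatible_bond[OF F k(2) i k(1) G_lsc[OF k]] by simp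
    also have "\<dots> \<le> F k (f k)"
      using k i G_lsc[OF k] G_le[OF k]
      by (intro compatible_mono[OF F] bond_lsc ascending_lsc[OF f])
    also have "\<dots> \<le> (SUP k\<in>I. F k (f k))"
      using k(1) by (rule SUP_upper)
    finally show "F i (G k) \<le> (SUP k\<in>I. F k (f k))" .
  qed
  finally show ?thesis .
qed

section \<open>Embedding-projection systems\<close>

text \<open>A point of the limit is determined by, and may be prescribed at, the indices above \<open>i\<close>, since
  these are cofinal.\<close>

lemma thread_extension:
  assumes i: "i \<in> I" and w: "\<And>k. \<lbrakk>k \<in> I; le i k\<rbrakk> \<Longrightarrow> w k \<in> topspace (X k)"
    and wp: "\<And>k l. \<lbrakk>k \<in> I; l \<in> I; le i k; le k l\<rbrakk> \<Longrightarrow> p k l (w l) = w k"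
  obtains z where "z \<in> topspace Z" "\<And>k. \<lbrakk>k \<in> I; le i k\<rbrakk> \<Longrightarrow> z k = w k"
proof -
  obtain m where m: "\<And>k. k \<in> I \<Longrightarrow> m k \<in> I \<and> le i (m k) \<and> le k (m k)"
    using upper_bound[OF i] by metis
  define z where "z = (\<lambda>k\<in>I. p k (m k) (w (m k)))"
  have z_eq: "z k = p k l (w l)" if k: "k \<in> I" and l: "l \<in> I" "le i l" "le k l" for k l
  proof -
    obtain n where n: "n \<in> I" "le (m k) n" "le l n"
      using upper_bound m[OF k] l(1) by blast
    have "p k a (w a) = p k n (w n)" if a: "a \<in> I" "le i a" "le k a" "le a n" for a
    proof -
      have "le i n"
        using le_trans[OF a(2,4) i a(1) n(1)] .
      then have "p k a (p a n (w n)) = p k n (w n)"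
        using p_comp a k n(1) w by simp
      then show ?thesis
        using wp[OF a(1) n(1) a(2,4)] by simp
    qed
    then have "p k (m k) (w (m k)) = p k l (w l)"
      using m[OF k] l n by metis
    then show ?thesis using k by (simp add: z_def)
  qed
  have "z \<in> topspace Z"
    unfolding topspace_limit
  proof (intro conjI ballI impI PiE_I)
    fix k assume k: "k \<in> I"
    then show "z k \<in> topspace (X k)"
      using m[OF k] w p_topspace by (simp add: z_def)
  next
    fix k l assume kl: "k \<in> I" "l \<in> I" "le k l"
    have ml: "m l \<in> I" "le i (m l)" "le l (m l)"
      using m[OF kl(2)] by auto
    have km: "le k (m l)"
      using le_trans[OF kl(3) ml(3) kl(1,2) ml(1)] .
    then show "p k l (z l) = z k"
      using z_eq[OF kl(2) ml] z_eq[OF kl(1) ml(1,2) km]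
        p_comp[OF kl(3) ml(3) kl(1,2) ml(1) w[OF ml(1,2)]] by simp
  qed (simp add: z_def)
  moreover have "z k = w k" if "k \<in> I" "le i k" for k
    using z_eq[OF that(1,1,2) le_refl[OF that(1)]] p_id w that by simp
  ultimately show thesis
    using that by blast
qed

text \<open>The embeddings \<open>e i k\<close> combine to an embedding of \<open>X i\<close> into the limit. Along it, the inequality
  on the limit is pulled back to \<open>X i\<close>, and there it says that the maps \<open>f k \<circ> e i k\<close> cover \<open>g\<close>.
  Pulled back to \<open>X k\<close>, they lie below \<open>f k\<close> because \<open>e i k \<circ> p i k \<le> id\<close>.\<close>

lemma cover_property_ep_system:
  assumes "ep_system I le X p"
  shows cover_property
proof -
  obtain e where
    e: "\<forall>i\<in>I. \<forall>j\<in>I. le i j \<longrightarrow>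
          continuous_map (X i) (X j) (e i j) \<and>
          (\<forall>x\<in>topspace (X i). p i j (e i j x) = x) \<and>
          (\<forall>x\<in>topspace (X j). specializes (X j) (e i j (p i j x)) x)" and
    ee': "\<forall>i\<in>I. \<forall>j\<in>I. \<forall>k\<in>I. le i j \<and> le j k \<longrightarrow>
          (\<forall>x\<in>topspace (X i). e j k (e i j x) = e i k x)"
    using assms unfolding ep_system_def by (elim conjE exE) (rule that)
  have e_cont: "continuous_map (X i) (X j) (e i j)" if "le i j" "i \<in> I" "j \<in> I" for i j
    using e that by simp
  have pe: "p i j (e i j x) = x" if "le i j" "i \<in> I" "j \<in> I" "x \<in> topspace (X i)" for i j x
    using e that by simp
  have ep: "specializes (X j) (e i j (p i j x)) x"
    if "le i j" "i \<in> I" "j \<in> I" "x \<in> topspace (X j)" for i j x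
    using e that by simp
  have ee: "e j k (e i j x) = e i k x"
    if "le i j" "le j k" "i \<in> I" "j \<in> I" "k \<in> I" "x \<in> topspace (X i)" for i j k x
    using ee' that by blast
  have e_top: "e i j x \<in> topspace (X j)" if "le i j" "i \<in> I" "j \<in> I" "x \<in> topspace (X i)" for i j x
    using continuous_map_image_subset_topspace[OF e_cont[OF that(1-3)]] that(4) by blast
  have pe_shift: "p k l (e i l x) = e i k x"
    if "le i k" "le k l" "i \<in> I" "k \<in> I" "l \<in> I" "x \<in> topspace (X i)" for i k l x
    using pe[of k l "e i k x"] ee[of i k l x] e_top[of i k x] that by simp
  show ?thesis
    unfolding cover_property_def
  proof (intro allI impI)
    fix F f i g
    assume F: "compatible F" and f: "ascending f" and i: "i \<in> I" and g: "g \<in> lsc_maps (X i)"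
      and le: "cone i g \<le> (SUP k\<in>I. cone k (f k))"
    define J where "J = {k \<in> I. le i k}"
    define G where "G k = lsc_pullback (X i) (e i k) (f k)" for k
    have J: "k \<in> I" "le i k" if "k \<in> J" for k
      using that by (auto simp: J_def)
    have G_lsc: "G k \<in> lsc_maps (X i)" if "k \<in> J" for k
      unfolding G_def
      using lsc_pullback_lsc_maps[OF e_cont ascending_lsc[OF f]] J[OF that] i by blast
    have G_mono: "G k \<le> G l" if "k \<in> J" "l \<in> J" "le k l" for k l
      unfolding G_def lsc_pullback_le_iff
    proof
      fix x assume x: "x \<in> topspace (X i)"
      have "p k l (e i l x) = e i k x"
        using pe_shift J[OF that(1)] J[OF that(2)] that(3) i x by simp
      then have "f k (e i k x) \<le> f l (e i l x)"
        using ascending_leD[OF f that(3), of "e i l x"] e_top[of i l x] J[OF that(1)] J[OF that(2)] i x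
        by simp
      then show "f k (e i k x) \<le> lsc_pullback (X i) (e i l) (f l) x"
        using x by (simp add: lsc_pullback_apply)
    qed
    have ub: "\<exists>m\<in>J. le k m \<and> le l m" if "k \<in> I" "l \<in> I" for k l
      using finite_upper_bound[of "{i, k, l}"] i that by (auto simp: J_def)
    have "g \<le> Sup (G ` J)"
    proof (rule le_funI)
      fix x
      show "g x \<le> Sup (G ` J) x"
      proof (cases "x \<in> topspace (X i)")
        case False
        then show ?thesis using lsc_maps_outside[OF g] by simp
      next
        case x: True
        obtain z where z: "z \<in> topspace Z" "\<And>k. k \<in> J \<Longrightarrow> z k = e i k x"
        proof (rule thread_extension[OF i, of "\<lambda>k. e i k x"])
          show "e i k x \<in> topspace (X k)" if "k \<in> I" "le i k" for k
            using e_top that i x by simp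
          show "p k l (e i l x) = e i k x" if "k \<in> I" "l \<in> I" "le i k" "le k l" for k l
            using pe_shift that i x by simp
        qed (use that J in blast)
        have "z i = x"
          using z(2)[of i] i le_refl[OF i] pe[of i i x] p_id[of i "e i i x"] e_top[of i i x] x
          by (simp add: J_def)
        then have "g x \<le> (SUP k\<in>I. f k (z k))"
          using le_funD[OF le, of z] i z(1)
          by (simp add: lsc_pullback_apply J_def image_image)
        also have "\<dots> \<le> (SUP k\<in>J. G k x)"
        proof (rule SUP_least)
          fix k assume k: "k \<in> I"
          then obtain m where m: "m \<in> J" "le k m"
            using ub[of k k] by blast
          have "f k (z k) \<le> f m (e i m x)"
            using ascending_leD[OF f m(2) k, of "z m"] limit_compat[OF z(1) m(2) k]
              limit_coord[OF z(1) J(1)[OF m(1)]] z(2)[OF m(1)] J(1)[OF m(1)] by simp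
          also have "\<dots> = G m x"
            using x by (simp add: G_def lsc_pullback_apply)
          also have "\<dots> \<le> (SUP k\<in>J. G k x)"
            using m(1) by (rule SUP_upper)
          finally show "f k (z k) \<le> (SUP k\<in>J. G k x)" .
        qed
        finally show ?thesis by (simp add: image_image)
      qed
    qed
    then have "g \<le> (SUP k\<in>{k \<in> I. le i k}. G k)"
      by (simp only: J_def)
    moreover have "bond i k (G k) \<le> f k" if k: "k \<in> J" for k
      unfolding lsc_pullback_le_iff
    proof
      fix y assume y: "y \<in> topspace (X k)"
      then have "f k (e i k (p i k y)) \<le> f k y"
        using J[OF k] i by (intro lsc_maps_mono_specializes[OF ascending_lsc[OF f]] ep)
      then show "G k (p i k y) \<le> f k y"
        using p_topspace[of i k y] J[OF k] i y by (simp add: G_def lsc_pullback_apply)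
    qed
    ultimately show "F i g \<le> (SUP k\<in>I. F k (f k))"
      using G_lsc G_mono by (intro bound_from_cover_at_stage[OF F f i g, of G]) (auto simp: J_def)
  qed
qed

section \<open>Threads avoiding an ascending family of open sets\<close>

text \<open>A form of Steenrod's theorem on limits of compact sets. By Zorn's lemma there is a maximal
  ascending family of open sets that contains \<open>E\<close> and still covers no \<open>Q k\<close>; compactness of \<open>Q k\<close>
  is what makes unions of chains admissible. By maximality, an open set that meets a complement
  \<open>C k\<close> cannot be added to the family together with its preimages, so it contains the image of
  some \<open>Q m \<inter> C m\<close>. Hence \<open>C k\<close> is irreducible: for two open sets that meet \<open>C k\<close> but have no
  common point in it, directedness would lead to an empty \<open>Q n \<inter> C n\<close>. Sobriety provides generic
  points of the \<open>C i\<close>, and the same argument shows that they form a thread. A generic point of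
  \<open>C k\<close> lies above every point of \<open>Q k \<inter> C k\<close>.\<close>

lemma sober_thread_avoiding:
  assumes sober: "\<And>i. i \<in> I \<Longrightarrow> sober_space (X i)"
    and K: "K \<subseteq> I" and cofinal: "\<And>i. i \<in> I \<Longrightarrow> \<exists>k\<in>K. le i k"
    and Q: "\<And>k. k \<in> K \<Longrightarrow> compactin (X k) (Q k)"
    and Qp: "\<And>k l y. \<lbrakk>k \<in> K; l \<in> K; le k l; y \<in> Q l\<rbrakk> \<Longrightarrow> p k l y \<in> Q k"
    and E: "\<And>i. i \<in> I \<Longrightarrow> openin (X i) (E i)"
    and Ep: "\<And>i j y. \<lbrakk>i \<in> I; j \<in> I; le i j; y \<in> topspace (X j); p i j y \<in> E i\<rbrakk> \<Longrightarrow> y \<in> E j"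
    and QE: "\<And>k. k \<in> K \<Longrightarrow> \<not> Q k \<subseteq> E k"
  obtains x where "x \<in> topspace Z" "\<And>i. i \<in> I \<Longrightarrow> x i \<notin> E i"
    "\<And>k. k \<in> K \<Longrightarrow> \<exists>y\<in>Q k. specializes (X k) y (x k)"
proof -
  have Q_top: "Q k \<subseteq> topspace (X k)" if "k \<in> K" for k
    using Q[OF that] by (rule compactin_subset_topspace)
  \<comment> \<open>A family of sets is coded as one subset of the disjoint sum, ordered by inclusion.\<close>
  define ok where "ok S \<longleftrightarrow> S \<subseteq> Sigma I (\<lambda>i. topspace (X i)) \<and>
      (\<forall>i\<in>I. openin (X i) (S `` {i})) \<and>
      (\<forall>i\<in>I. \<forall>j\<in>I. \<forall>y\<in>topspace (X j). le i j \<longrightarrow> (i, p i j y) \<in> S \<longrightarrow> (j, y) \<in> S) \<and>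
      (\<forall>k\<in>K. \<not> Q k \<subseteq> S `` {k})" for S :: "('i \<times> 'a) set"
  have ok0: "ok (Sigma I E)"
  proof -
    have "Sigma I E `` {i} = E i" if "i \<in> I" for i
      using that by auto
    moreover have "E i \<subseteq> topspace (X i)" if "i \<in> I" for i
      using openin_subset[OF E[OF that]] .
    ultimately show ?thesis
      unfolding ok_def using E Ep QE K by (auto dest: subsetD)
  qed
  have "\<exists>M\<in>{S. ok S \<and> Sigma I E \<subseteq> S}. \<forall>S\<in>{S. ok S \<and> Sigma I E \<subseteq> S}. M \<subseteq> S \<longrightarrow> S = M"
  proof (rule subset_Zorn_nonempty)
    show "{S. ok S \<and> Sigma I E \<subseteq> S} \<noteq> {}"
      using ok0 by blast
  next
    fix \<C> assume ne: "\<C> \<noteq> {}" and "subset.chain {S. ok S \<and> Sigma I E \<subseteq> S} \<C>"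
    then have C: "\<And>S. S \<in> \<C> \<Longrightarrow> ok S" "\<And>S. S \<in> \<C> \<Longrightarrow> Sigma I E \<subseteq> S"
      and chain: "\<And>S T. S \<in> \<C> \<Longrightarrow> T \<in> \<C> \<Longrightarrow> S \<subseteq> T \<or> T \<subseteq> S"
      by (auto simp: subset_chain_def)
    have eq: "(\<Union>\<C>) `` {i} = (\<Union>S\<in>\<C>. S `` {i})" for i
      by auto
    have "ok (\<Union>\<C>)"
      unfolding ok_def
    proof (intro conjI ballI impI notI)
      show "\<Union>\<C> \<subseteq> Sigma I (\<lambda>i. topspace (X i))"
        using C(1) unfolding ok_def by blast
    next
      fix i assume "i \<in> I"
      then show "openin (X i) ((\<Union>\<C>) `` {i})"
        unfolding eq using C(1) by (intro openin_Union) (auto simp: ok_def)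
    next
      fix i j y assume "i \<in> I" "j \<in> I" "y \<in> topspace (X j)" "le i j" "(i, p i j y) \<in> \<Union>\<C>"
      then show "(j, y) \<in> \<Union>\<C>"
        using C(1) unfolding ok_def by blast
    next
      fix k assume k: "k \<in> K" and "Q k \<subseteq> (\<Union>\<C>) `` {k}"
      then have sub: "Q k \<subseteq> \<Union>((\<lambda>S. S `` {k}) ` \<C>)"
        by (simp add: eq)
      have op: "\<forall>U\<in>(\<lambda>S. S `` {k}) ` \<C>. openin (X k) U"
        using C(1) k K by (auto simp: ok_def)
      obtain \<F> where \<F>: "finite \<F>" "\<F> \<subseteq> (\<lambda>S. S `` {k}) ` \<C>" "Q k \<subseteq> \<Union>\<F>"
        using compactinD[OF Q[OF k], of "(\<lambda>S. S `` {k}) ` \<C>"] sub op by auto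
      have "\<F> \<noteq> {}"
        using \<F>(3) QE[OF k] by auto
      moreover have "U \<subseteq> V \<or> V \<subseteq> U" if "U \<in> \<F>" "V \<in> \<F>" for U V
      proof -
        obtain S T where ST: "S \<in> \<C>" "T \<in> \<C>" "U = S `` {k}" "V = T `` {k}"
          using subsetD[OF \<F>(2) \<open>U \<in> \<F>\<close>] subsetD[OF \<F>(2) \<open>V \<in> \<F>\<close>] by (elim imageE) (rule that)
        show ?thesis
          using chain[OF ST(1,2)] unfolding ST(3,4) by (meson Image_mono order_refl)
      qed
      then have "subset.chain UNIV \<F>"
        by (auto simp: subset_chain_def)
      ultimately have "\<Union>\<F> \<in> \<F>"
        using \<F>(1) by (intro Union_in_chain)
      then have "\<Union>\<F> \<in> (\<lambda>S. S `` {k}) ` \<C>"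
        by (rule subsetD[OF \<F>(2)])
      then obtain S where "S \<in> \<C>" "\<Union>\<F> = S `` {k}"
        by (elim imageE) (rule that)
      then show False
        using C(1)[of S] \<F>(3) k by (simp add: ok_def)
    qed
    then show "\<Union>\<C> \<in> {S. ok S \<and> Sigma I E \<subseteq> S}"
      using C(2) ne by blast
  qed
  then obtain M where M': "M \<in> {S. ok S \<and> Sigma I E \<subseteq> S}"
    and max': "\<forall>S\<in>{S. ok S \<and> Sigma I E \<subseteq> S}. M \<subseteq> S \<longrightarrow> S = M"
    by (elim bexE) (rule that)
  from M' have M: "ok M" "Sigma I E \<subseteq> M"
    by simp_all
  have max: "S = M" if "ok S" "M \<subseteq> S" for S
    using bspec[OF max', of S] that order_trans[OF M(2) that(2)] by simp
  define C where "C i = topspace (X i) - M `` {i}" for i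
  have M_op: "openin (X i) (M `` {i})" if "i \<in> I" for i
    using M(1) that by (simp add: ok_def)
  have M_p: "(j, y) \<in> M" if "i \<in> I" "j \<in> I" "le i j" "y \<in> topspace (X j)" "(i, p i j y) \<in> M" for i j y
    using M(1) that by (simp add: ok_def)
  have M_Q: "\<exists>y\<in>Q k. y \<in> C k" if "k \<in> K" for k
  proof -
    have "\<not> Q k \<subseteq> M `` {k}"
      using M(1) that by (simp add: ok_def)
    then show ?thesis
      using Q_top[OF that] unfolding C_def by blast
  qed
  have C_closed: "closedin (X i) (C i)" if "i \<in> I" for i
    unfolding C_def using M_op[OF that] by blast
  have C_p: "p i j y \<in> C i" if "i \<in> I" "j \<in> I" "le i j" "y \<in> C j" for i j y
    using that M_p[OF that(1-3)] p_topspace[OF that(3,1,2)] by (auto simp: C_def)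
  \<comment> \<open>Otherwise the complement of \<open>A\<close> and its preimages could be added to the family.\<close>
  have escape: "\<exists>m\<in>K. le k m \<and> (\<forall>z\<in>Q m. z \<in> C m \<longrightarrow> p k m z \<notin> A)"
    if k: "k \<in> I" and A: "closedin (X k) A" and nA: "\<not> C k \<subseteq> A" for k A
  proof (rule ccontr)
    assume no: "\<not> ?thesis"
    define S where "S = M \<union> {(l, y). l \<in> I \<and> le k l \<and> y \<in> topspace (X l) \<and> p k l y \<notin> A}"
    have S_eq: "S `` {l} = (if le k l then M `` {l} \<union> {y \<in> topspace (X l). p k l y \<in> topspace (X k) - A}
        else M `` {l})" if "l \<in> I" for l
      using that p_topspace[of k l] k by (auto simp: S_def)
    have "ok S"
      unfolding ok_def
    proof (intro conjI ballI impI)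
      show "S \<subseteq> Sigma I (\<lambda>i. topspace (X i))"
        using M(1) by (auto simp: ok_def S_def)
    next
      fix i assume i: "i \<in> I"
      have "openin (X k) (topspace (X k) - A)"
        using A by blast
      then show "openin (X i) (S `` {i})"
        using M_op[OF i] openin_Un[OF M_op[OF i] openin_preimage[OF _ k i]]
        by (simp only: S_eq[OF i] split: if_split) blast
    next
      fix i j y assume ij: "i \<in> I" "j \<in> I" "y \<in> topspace (X j)" "le i j" "(i, p i j y) \<in> S"
      then consider "(i, p i j y) \<in> M" | "le k i" "p k i (p i j y) \<notin> A"
        by (auto simp: S_def)
      then show "(j, y) \<in> S"
      proof cases
        case 1
        then show ?thesis using M_p ij by (auto simp: S_def)
      next
        case 2
        then show ?thesis
          using p_comp[OF 2(1) ij(4) k ij(1,2,3)] le_trans[OF 2(1) ij(4) k ij(1,2)] ij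
          by (simp add: S_def)
      qed
    next
      fix l assume l: "l \<in> K"
      then have lI: "l \<in> I" using K by blast
      show "\<not> Q l \<subseteq> S `` {l}"
      proof (cases "le k l")
        case True
        then obtain z where "z \<in> Q l" "z \<in> C l" "p k l z \<in> A"
          using no l by blast
        then show ?thesis
          using True lI by (auto simp: S_eq C_def)
      next
        case False
        then show ?thesis
          using M(1) l lI by (simp add: S_eq ok_def)
      qed
    qed
    then have "S = M"
      by (rule max) (simp add: S_def)
    moreover obtain y where "y \<in> C k" "y \<notin> A"
      using nA by blast
    ultimately show False
      using k le_refl[OF k] p_id[OF k] by (auto simp: S_def C_def)
  qed
  have KI: "k \<in> I" if "k \<in> K" for k
    using K that by blast
  have irred: "irreducible_closedin (X k) (C k)" if k: "k \<in> I" for k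
    unfolding irreducible_closedin_def
  proof (intro conjI allI impI)
    show "closedin (X k) (C k)"
      using k by (rule C_closed)
    obtain m where "m \<in> K" "le k m" using cofinal[OF k] by blast
    then show "C k \<noteq> {}"
      using M_Q[of m] C_p[of k m] k KI by blast
    fix A B assume AB: "closedin (X k) A \<and> closedin (X k) B \<and> C k \<subseteq> A \<union> B"
    show "C k \<subseteq> A \<or> C k \<subseteq> B"
    proof (rule ccontr)
      assume "\<not> (C k \<subseteq> A \<or> C k \<subseteq> B)"
      then obtain l m where l: "l \<in> K" "le k l" "\<forall>z\<in>Q l. z \<in> C l \<longrightarrow> p k l z \<notin> A"
        and m: "m \<in> K" "le k m" "\<forall>z\<in>Q m. z \<in> C m \<longrightarrow> p k m z \<notin> B"
        using escape[OF k, of A] escape[OF k, of B] AB by blast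
      obtain n' where n': "n' \<in> I" "le l n'" "le m n'"
        using upper_bound[of l m] l m KI by blast
      then obtain n where n: "n \<in> K" "le n' n"
        using cofinal by blast
      have ln: "le l n" "le m n" "le k n"
        using le_trans n' n l(1,2) m(1) k KI by metis+
      obtain z where z: "z \<in> Q n" "z \<in> C n"
        using M_Q[OF n(1)] by blast
      have zt: "z \<in> topspace (X n)"
        using z(2) by (simp add: C_def)
      have "p k n z \<notin> A"
        using l z Qp[OF l(1) n(1) ln(1) z(1)] C_p[of l n z] p_comp[OF l(2) ln(1) k _ _ zt] ln KI n(1)
        by fastforce
      moreover have "p k n z \<notin> B"
        using m z Qp[OF m(1) n(1) ln(2) z(1)] C_p[of m n z] p_comp[OF m(2) ln(2) k _ _ zt] ln KI n(1)
        by fastforce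
      moreover have "p k n z \<in> C k"
        using C_p[OF k KI[OF n(1)] ln(3) z(2)] .
      ultimately show False
        using AB by blast
    qed
  qed
  have "\<exists>x\<in>topspace (X k). C k = X k closure_of {x}" if "k \<in> I" for k
    using sober[OF that] irred[OF that] by (simp add: sober_space_def)
  then obtain x0 where x0: "\<And>k. k \<in> I \<Longrightarrow> x0 k \<in> topspace (X k)"
      "\<And>k. k \<in> I \<Longrightarrow> C k = X k closure_of {x0 k}"
    by metis
  have in_cl: "x0 k \<in> C k" if "k \<in> I" for k
    using x0[OF that] closure_of_subset[of "{x0 k}" "X k"] by auto
  have compat: "p k l (x0 l) = x0 k" if kl: "k \<in> I" "l \<in> I" "le k l" for k l
  proof -
    let ?A = "X k closure_of {p k l (x0 l)}"
    have pt: "p k l (x0 l) \<in> topspace (X k)"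
      using p_topspace[OF kl(3,1,2)] x0(1)[OF kl(2)] .
    have "C k \<subseteq> ?A"
    proof (rule ccontr)
      assume "\<not> C k \<subseteq> ?A"
      then obtain m where m: "m \<in> K" "le k m" "\<forall>z\<in>Q m. z \<in> C m \<longrightarrow> p k m z \<notin> ?A"
        using escape[OF kl(1), of ?A] by auto
      obtain n' where n': "n' \<in> I" "le l n'" "le m n'"
        using upper_bound[of l m] kl m KI by blast
      then obtain n where n: "n \<in> K" "le n' n"
        using cofinal by blast
      have ln: "le l n" "le m n"
        using le_trans n' n kl m(1) KI by metis+
      obtain z where z: "z \<in> Q n" "z \<in> C n"
        using M_Q[OF n(1)] by blast
      have zt: "z \<in> topspace (X n)"
        using z(2) by (simp add: C_def)
      have "p k n z \<notin> ?A"
        using m z Qp[OF m(1) n(1) ln(2) z(1)] C_p[of m n z] p_comp[OF m(2) ln(2) kl(1) _ _ zt] KI n(1) ln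
        by fastforce
      moreover have "p l n z \<in> X l closure_of {x0 l}"
        using C_p[OF kl(2) KI[OF n(1)] ln(1) z(2)] x0(2)[OF kl(2)] by simp
      then have "p k l (p l n z) \<in> ?A"
        using continuous_map_image_closure_subset[OF p_continuous[OF kl(3,1,2)], of "{x0 l}"] by auto
      ultimately show False
        using p_comp[OF kl(3) ln(1) kl(1,2) KI[OF n(1)] zt] by simp
    qed
    moreover have "?A \<subseteq> C k"
      using C_p[OF kl in_cl[OF kl(2)]] C_closed[OF kl(1)] by (intro closure_of_minimal) auto
    ultimately have "X k closure_of {x0 k} = ?A"
      using x0(2)[OF kl(1)] by blast
    moreover have "t0_space (X k)"
      using sober[OF kl(1)] by (simp add: sober_space_def)
    ultimately show ?thesis
      using pt x0(1)[OF kl(1)] unfolding t0_space_closure_of_sing by blast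
  qed
  show thesis
  proof (rule that[of "restrict x0 I"])
    show "restrict x0 I \<in> topspace Z"
      using x0(1) compat by (auto simp: topspace_limit)
    show "restrict x0 I i \<notin> E i" if "i \<in> I" for i
      using in_cl[OF that] M(2) that by (auto simp: C_def)
    show "\<exists>y\<in>Q k. specializes (X k) y (restrict x0 I k)" if k: "k \<in> K" for k
    proof -
      obtain y where y: "y \<in> Q k" "y \<in> X k closure_of {x0 k}"
        using M_Q[OF k] x0(2) KI[OF k] by blast
      then have "specializes (X k) y (x0 k)"
        using x0(1)[OF KI[OF k]] by (auto simp: specializes_def in_closure_of)
      then show ?thesis
        using y(1) KI[OF k] by auto
    qed
  qed
qed

end

section \<open>Systems of proper maps\<close>

lemma compact_saturated_up_closure:
  assumes "x \<in> topspace X"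
  shows "compact_saturated_in X {y. specializes X x y}"
  unfolding compact_saturated_in_def
proof
  have x: "specializes X x x"
    using assms by (simp add: specializes_def)
  show "compactin X {y. specializes X x y}"
    unfolding compactin_def
  proof (intro conjI allI impI)
    show "{y. specializes X x y} \<subseteq> topspace X"
      by (auto simp: specializes_def)
    fix \<U> assume U: "Ball \<U> (openin X) \<and> {y. specializes X x y} \<subseteq> \<Union>\<U>"
    then obtain U where "U \<in> \<U>" "x \<in> U"
      using x by blast
    moreover from this have "{y. specializes X x y} \<subseteq> U"
      using U by (auto simp: specializes_def)
    ultimately show "\<exists>\<F>. finite \<F> \<and> \<F> \<subseteq> \<U> \<and> {y. specializes X x y} \<subseteq> \<Union>\<F>"
      by (intro exI[of _ "{U}"]) auto
  qed
  show "saturatedin X {y. specializes X x y}"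
    by (auto simp: saturatedin_def specializes_def)
qed

context projective
begin

text \<open>Here the right adjoint of \<open>bond i k\<close> has a formula: at \<open>x\<close>, its value \<open>G k\<close> at \<open>f k\<close> is the
  infimum of \<open>f k\<close> on the points that \<open>p i k\<close> maps above \<open>x\<close>. It is lower semicontinuous because
  \<open>p i k\<close> sends closed sets to closed sets up to downward closure. The set of points over which
  the infimum is taken is compact, as the preimage of a compact saturated set.
  So if \<open>G k x < s < g x\<close> for all \<open>k\<close>, there is a thread above \<open>x\<close> on which all \<open>f k\<close> are at most
  \<open>s\<close>, against the inequality on the limit.\<close>

lemma cover_property_order_proper:
  assumes sober: "\<And>i. i \<in> I \<Longrightarrow> sober_space (X i)"
    and proper: "\<And>i j. \<lbrakk>le i j; i \<in> I; j \<in> I\<rbrakk> \<Longrightarrow> order_proper_map (X j) (X i) (p i j)"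
  shows cover_property
  unfolding cover_property_def
proof (intro allI impI)
  fix F f i g
  assume F: "compatible F" and f: "ascending f" and i: "i \<in> I" and g: "g \<in> lsc_maps (X i)"
    and le: "cone i g \<le> (SUP k\<in>I. cone k (f k))"
  define fibre where "fibre k x = {y \<in> topspace (X k). specializes (X i) x (p i k y)}" for k x
  \<comment> \<open>Over an empty fibre the infimum is \<open>\<infinity>\<close>: such a point \<open>x\<close> imposes no constraint.\<close>
  define G where "G k x = (if x \<in> topspace (X i) then INF y\<in>fibre k x. f k y else 0)" for k x
  show "F i g \<le> (SUP k\<in>I. F k (f k))"
  proof (rule bound_from_cover_at_stage[OF F f i g, of G])
    fix k assume k: "k \<in> I" "le i k"
    show "G k \<in> lsc_maps (X i)"
      unfolding lsc_maps_iff
    proof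
      fix r
      define D where "D s = downward_closure (X i) (p i k ` {y \<in> topspace (X k). f k y \<le> s})" for s
      have D: "x \<notin> D s \<longleftrightarrow> (\<forall>y\<in>fibre k x. s < f k y)" for x s
        unfolding D_def downward_closure_def fibre_def by (auto simp: not_less[symmetric])
      have eq: "{x. r < G k x} = (\<Union>s\<in>{r<..}. topspace (X i) - D s)"
      proof (intro subset_antisym subsetI)
        fix x assume "x \<in> {x. r < G k x}"
        then have x: "x \<in> topspace (X i)" "r < (INF y\<in>fibre k x. f k y)"
          by (auto simp: G_def split: if_splits)
        then obtain s where s: "r < s" "s < (INF y\<in>fibre k x. f k y)"
          using dense by blast
        then have "\<forall>y\<in>fibre k x. s < f k y"
          by (auto intro: less_le_trans INF_lower)
        then show "x \<in> (\<Union>s\<in>{r<..}. topspace (X i) - D s)"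
          using s(1) x(1) D by blast
      next
        fix x assume "x \<in> (\<Union>s\<in>{r<..}. topspace (X i) - D s)"
        then obtain s where s: "r < s" "x \<in> topspace (X i)" "\<forall>y\<in>fibre k x. s < f k y"
          using D by blast
        have "s \<le> (INF y\<in>fibre k x. f k y)"
          using s(3) by (intro INF_greatest) (auto intro: less_imp_le)
        then show "x \<in> {x. r < G k x}"
          using s by (auto simp: G_def)
      qed
      have op: "openin (X i) (topspace (X i) - D s)" for s
      proof -
        have "{y \<in> topspace (X k). f k y \<le> s} = topspace (X k) - {y. s < f k y}"
          by auto
        then have "closedin (X k) {y \<in> topspace (X k). f k y \<le> s}"
          using lsc_maps_openin[OF ascending_lsc[OF f k(1)], of s] by auto
        then have "closedin (X i) (D s)"
          using proper[OF k(2) i k(1)] by (simp add: order_proper_map_def D_def)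
        then show ?thesis by blast
      qed
      show "openin (X i) {x. r < G k x}"
        unfolding eq by (rule openin_Union) (elim imageE, simp only: op)
    qed
    show "bond i k (G k) \<le> f k"
      unfolding lsc_pullback_le_iff
    proof
      fix y assume y: "y \<in> topspace (X k)"
      then have "p i k y \<in> topspace (X i)"
        by (rule p_topspace[OF k(2) i k(1)])
      moreover from this have "y \<in> fibre k (p i k y)"
        using y by (simp add: fibre_def specializes_def)
      ultimately show "G k (p i k y) \<le> f k y"
        by (simp add: G_def INF_lower)
    qed
  next
    fix k l assume kl: "k \<in> I" "l \<in> I" "le i k" "le k l"
    show "G k \<le> G l"
    proof (rule le_funI)
      fix x
      have "(INF y\<in>fibre k x. f k y) \<le> f l y" if "y \<in> fibre l x" for y
      proof -
        have y: "y \<in> topspace (X l)"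
          using that by (simp add: fibre_def)
        then have "p k l y \<in> fibre k x"
          using that p_comp[OF kl(3,4) i kl(1,2) y] p_topspace[OF kl(4,1,2) y] by (simp add: fibre_def)
        then have "(INF y\<in>fibre k x. f k y) \<le> f k (p k l y)"
          by (rule INF_lower)
        also have "\<dots> \<le> f l y"
          by (rule ascending_leD[OF f kl(4,1,2) y])
        finally show ?thesis .
      qed
      then show "G k x \<le> G l x"
        by (simp add: G_def INF_greatest)
    qed
  next
    show "g \<le> (SUP k\<in>{k \<in> I. le i k}. G k)"
    proof (rule le_funI)
      fix x
      show "g x \<le> (SUP k\<in>{k \<in> I. le i k}. G k) x"
      proof (cases "x \<in> topspace (X i)")
        case False
        then show ?thesis using lsc_maps_outside[OF g] by simp
      next
        case x: True
        show ?thesis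
        proof (rule ccontr)
          assume "\<not> ?thesis"
          then have "(SUP k\<in>{k \<in> I. le i k}. G k) x < g x"
            by (simp only: not_le)
          from dense[OF this] obtain s where s: "(SUP k\<in>{k \<in> I. le i k}. G k) x < s" "s < g x"
            by blast
          have not_sub: "\<not> fibre k x \<subseteq> {y. s < f k y}" if k: "k \<in> {k \<in> I. le i k}" for k
          proof
            assume "fibre k x \<subseteq> {y. s < f k y}"
            then have "s \<le> (INF y\<in>fibre k x. f k y)"
              by (intro INF_greatest) (auto intro: less_imp_le)
            then have "s \<le> G k x"
              using x by (simp add: G_def)
            also have "\<dots> \<le> (SUP k\<in>{k \<in> I. le i k}. G k) x"
              using k by (auto intro!: SUP_upper)
            finally show False using s(1) by simp
          qed
          obtain z where z: "z \<in> topspace Z" "\<And>k. k \<in> I \<Longrightarrow> z k \<notin> {y. s < f k y}"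
              "\<And>k. k \<in> {k \<in> I. le i k} \<Longrightarrow> \<exists>y\<in>fibre k x. specializes (X k) y (z k)"
          proof (rule sober_thread_avoiding[where K = "{k \<in> I. le i k}" and Q = "\<lambda>k. fibre k x"
                and E = "\<lambda>k. {y. s < f k y}"])
            show "\<exists>k\<in>{k \<in> I. le i k}. le j k" if "j \<in> I" for j
              using upper_bound[OF i that] by blast
            show "compactin (X k) (fibre k x)" if "k \<in> {k \<in> I. le i k}" for k
            proof -
              have "compact_saturated_in (X k) {y \<in> topspace (X k). p i k y \<in> {y. specializes (X i) x y}}"
                using proper[of i k] that i compact_saturated_up_closure[OF x]
                unfolding order_proper_map_def by blast
              then show ?thesis
                by (simp add: compact_saturated_in_def fibre_def)
            qed
            show "p k l y \<in> fibre k x"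
              if "k \<in> {k \<in> I. le i k}" "l \<in> {k \<in> I. le i k}" "le k l" "y \<in> fibre l x" for k l y
              using that p_comp[of i k l y] p_topspace[of k l y] i by (simp add: fibre_def)
            show "y \<in> {y. s < f l y}"
              if "k \<in> I" "l \<in> I" "le k l" "y \<in> topspace (X l)" "p k l y \<in> {y. s < f k y}" for k l y
              using ascending_leD[OF f that(3,1,2,4)] that(5) by auto
          qed (use sober not_sub lsc_maps_openin[OF ascending_lsc[OF f]] in auto)
          obtain y where y: "y \<in> fibre i x" "specializes (X i) y (z i)"
            using z(3)[of i] i le_refl by blast
          then have "specializes (X i) x y"
            using p_id[OF i, of y] by (simp add: fibre_def)
          then have "g x \<le> g (z i)"
            using lsc_maps_mono_specializes[OF g] y(2) by (blast intro: order_trans)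
          also have "\<dots> \<le> (SUP k\<in>I. f k (z k))"
            using le_funD[OF le, of z] z(1) by (simp add: lsc_pullback_apply image_image)
          also have "\<dots> \<le> s"
            using z(2) by (intro SUP_least) (simp add: not_less)
          finally show False using s(2) by simp
        qed
      qed
    qed
  qed
qed

end

section \<open>Sequences of locally compact spaces\<close>

text \<open>With a finite set \<open>S\<close> of values fixed, a step map is given by finitely many open sets, and
  approximating the map from below amounts to approximating these sets from inside.\<close>

definition step_map :: "ennreal set \<Rightarrow> (ennreal \<Rightarrow> 'b set) \<Rightarrow> 'b \<Rightarrow> ennreal" where
  "step_map S V x = Sup {t \<in> S. x \<in> V t}"

lemma step_map_le_iff: "step_map S V \<le> h \<longleftrightarrow> (\<forall>t\<in>S. \<forall>x\<in>V t. t \<le> h x)"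
  by (auto simp: le_fun_def step_map_def Sup_le_iff)

lemma step_map_mono: "(\<And>t. t \<in> S \<Longrightarrow> V t \<subseteq> W t) \<Longrightarrow> step_map S V \<le> step_map S W"
  unfolding step_map_def le_fun_def by (blast intro: Sup_subset_mono)

lemma lsc_maps_step_map:
  assumes "\<And>t. t \<in> S \<Longrightarrow> openin X (V t)"
  shows "step_map S V \<in> lsc_maps X"
proof -
  have "{x. r < step_map S V x} = (\<Union>t\<in>{t \<in> S. r < t}. V t)" for r
    by (auto simp: step_map_def less_Sup_iff)
  then show ?thesis
    using assms by (auto simp: lsc_maps_iff)
qed

lemma lsc_pullback_step_map:
  "lsc_pullback Y q (step_map S V) = step_map S (\<lambda>t. {y \<in> topspace Y. q y \<in> V t})"
proof
  fix y
  show "lsc_pullback Y q (step_map S V) y = step_map S (\<lambda>t. {y \<in> topspace Y. q y \<in> V t}) y"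
    by (cases "y \<in> topspace Y") (simp_all add: lsc_pullback_def step_map_def flip: bot_ennreal)
qed

lemma approximation_by_finite_step_map:
  assumes F: "preserves_directed_Sup X F" and h: "h \<in> lsc_maps X" and r: "r < F h"
  shows "\<exists>S. finite S \<and> r < F (step_map S (\<lambda>t. {x. t < h x}))"
proof -
  let ?s = "\<lambda>S. step_map S (\<lambda>t. {x. t < h x})"
  let ?D = "?s ` {S. finite S}"
  have mono: "?s S \<le> ?s T" if "S \<subseteq> T" for S T
    unfolding step_map_def le_fun_def using that by (blast intro: Sup_subset_mono)
  have "directed_set ?D"
    unfolding directed_set_def
  proof (intro conjI ballI)
    show "?D \<noteq> {}" by blast
    fix u v assume "u \<in> ?D" "v \<in> ?D"
    then obtain S T where "finite S" "finite T" "u = ?s S" "v = ?s T" by blast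
    then show "\<exists>z\<in>?D. u \<le> z \<and> v \<le> z"
      using mono[of S "S \<union> T"] mono[of T "S \<union> T"] by (intro bexI[of _ "?s (S \<union> T)"]) auto
  qed
  moreover have "?D \<subseteq> lsc_maps X"
    using lsc_maps_openin[OF h] by (blast intro: lsc_maps_step_map)
  moreover have "Sup ?D = h"
  proof (rule antisym)
    show "Sup ?D \<le> h"
      by (intro SUP_least) (auto simp: step_map_le_iff)
    show "h \<le> Sup ?D"
    proof (rule le_funI, rule dense_le)
      fix x t assume t: "t < h x"
      have "t \<le> ?s {t} x"
        unfolding step_map_def using t by (intro Sup_upper) simp
      also have "\<dots> \<le> Sup ?D x"
        by (intro le_funD[OF Sup_upper] imageI) simp
      finally show "t \<le> Sup ?D x" .
    qed
  qed
  ultimately have "F h = (SUP u\<in>?D. F u)"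
    using preserves_directed_SupD[OF F, of ?D] by simp
  then have "r < (SUP S\<in>{S. finite S}. F (?s S))"
    using r by (simp add: image_image)
  then show ?thesis
    by (auto simp: less_SUP_iff)
qed

text \<open>In a locally compact space, an open set is the directed union of the open sets that are enclosed
  in a compact subset of it. Doing this simultaneously for all values in \<open>S\<close> writes \<open>step_map S W\<close>
  as a directed supremum.\<close>

lemma approximation_by_compacts:
  assumes X: "strongly_locally_compact_space X"
    and F: "preserves_directed_Sup X F" and W: "\<And>t. t \<in> S \<Longrightarrow> openin X (W t)"
    and r: "r < F (step_map S W)"
  shows "\<exists>V K. (\<forall>t\<in>S. openin X (V t) \<and> compactin X (K t) \<and> V t \<subseteq> K t \<and> K t \<subseteq> W t) \<and>
    r < F (step_map S V)"
proof -
  define ok where "ok V \<longleftrightarrow> (\<forall>t\<in>S. openin X (V t) \<and> (\<exists>K. compactin X K \<and> V t \<subseteq> K \<and> K \<subseteq> W t))" for V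
  let ?D = "step_map S ` {V. ok V}"
  have "directed_set ?D"
    unfolding directed_set_def
  proof (intro conjI ballI)
    have "ok (\<lambda>_. {})"
      by (auto simp: ok_def intro: exI[of _ "{}"])
    then show "?D \<noteq> {}" by blast
    fix u v assume "u \<in> ?D" "v \<in> ?D"
    then obtain V V' where V: "ok V" "ok V'" "u = step_map S V" "v = step_map S V'" by blast
    have "ok (\<lambda>t. V t \<union> V' t)"
      unfolding ok_def
    proof (intro ballI conjI)
      fix t assume t: "t \<in> S"
      then show "openin X (V t \<union> V' t)"
        using V by (auto simp: ok_def)
      obtain K K' where "compactin X K" "V t \<subseteq> K" "K \<subseteq> W t" "compactin X K'" "V' t \<subseteq> K'" "K' \<subseteq> W t"
        using V(1,2) t unfolding ok_def by blast
      then show "\<exists>K. compactin X K \<and> V t \<union> V' t \<subseteq> K \<and> K \<subseteq> W t"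
        by (intro exI[of _ "K \<union> K'"]) (auto intro: compactin_Un)
    qed
    then show "\<exists>z\<in>?D. u \<le> z \<and> v \<le> z"
      using V(3,4) by (intro bexI[of _ "step_map S (\<lambda>t. V t \<union> V' t)"]) (auto intro!: step_map_mono)
  qed
  moreover have "?D \<subseteq> lsc_maps X"
    by (auto simp: ok_def intro!: lsc_maps_step_map)
  moreover have sup: "step_map S W \<le> Sup ?D"
    unfolding step_map_le_iff
  proof (intro ballI)
    fix t x assume t: "t \<in> S" and x: "x \<in> W t"
    have "\<exists>U K. openin X U \<and> compactin X K \<and> x \<in> U \<and> U \<subseteq> K \<and> K \<subseteq> W t"
      using X[unfolded strongly_locally_compact_space_def neighbourhood_base_of,
          THEN spec, THEN spec, THEN mp, OF conjI, OF W[OF t] x] .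
    then obtain U K where U: "openin X U" "compactin X K" "x \<in> U" "U \<subseteq> K" "K \<subseteq> W t"
      by (elim exE conjE) (rule that)
    let ?V = "\<lambda>s. if s = t then U else {}"
    have "ok ?V"
      using U unfolding ok_def by (auto intro: exI[of _ "{}"])
    then have "step_map S ?V \<le> Sup ?D"
      by (intro Sup_upper) blast
    moreover have "t \<le> step_map S ?V x"
      using t U(3) by (auto simp: step_map_def intro: Sup_upper)
    ultimately show "t \<le> Sup ?D x"
      by (meson le_funD order_trans)
  qed
  ultimately have "F (step_map S W) \<le> (SUP u\<in>?D. F u)"
    using preserves_directed_SupD[OF F, of ?D]
      preserves_directed_Sup_mono[OF F lsc_maps_step_map[OF W] lsc_maps_Sup sup] by simp
  then have "r < (SUP V\<in>{V. ok V}. F (step_map S V))"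
    using r by (simp add: image_image)
  then obtain V where V: "ok V" "r < F (step_map S V)"
    by (auto simp: less_SUP_iff)
  then show ?thesis
    unfolding ok_def by metis
qed

context projective
begin

lemma cofinal_sequence:
  assumes "has_countable_cofinal_subset I le" and i: "i \<in> I"
  obtains \<sigma> :: "nat \<Rightarrow> 'i" where "\<And>n. \<sigma> n \<in> I" "le i (\<sigma> 0)" "\<And>m n. m \<le> n \<Longrightarrow> le (\<sigma> m) (\<sigma> n)"
    "\<And>k. k \<in> I \<Longrightarrow> \<exists>n. le k (\<sigma> n)"
proof -
  obtain J where J: "J \<subseteq> I" "countable J" "\<And>k. k \<in> I \<Longrightarrow> \<exists>j\<in>J. le k j"
    using assms unfolding has_countable_cofinal_subset_def by blast
  then have "J \<noteq> {}"
    using i by blast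
  define c where "c = from_nat_into J"
  have c: "c n \<in> I" for n
    using from_nat_into[OF \<open>J \<noteq> {}\<close>] J(1) by (auto simp: c_def)
  have "\<exists>\<sigma>. \<forall>n. (\<sigma> n \<in> I \<and> le i (\<sigma> n)) \<and> (le (\<sigma> n) (\<sigma> (Suc n)) \<and> le (c n) (\<sigma> (Suc n)))"
  proof (rule dependent_nat_choice)
    show "\<exists>x. x \<in> I \<and> le i x"
      using i le_refl by blast
    fix x and n :: nat assume x: "x \<in> I \<and> le i x"
    then obtain y where "y \<in> I" "le x y" "le (c n) y"
      using upper_bound c by blast
    then show "\<exists>y. (y \<in> I \<and> le i y) \<and> le x y \<and> le (c n) y"
      using le_trans x i by blast
  qed
  then obtain \<sigma> where \<sigma>: "\<And>n. \<sigma> n \<in> I" "\<And>n. le i (\<sigma> n)" "\<And>n. le (\<sigma> n) (\<sigma> (Suc n))"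
      "\<And>n. le (c n) (\<sigma> (Suc n))"
    by blast
  have mono: "le (\<sigma> m) (\<sigma> n)" if "m \<le> n" for m n
    using that
  proof (induction n rule: dec_induct)
    case base
    then show ?case using le_refl \<sigma>(1) .
  next
    case (step n)
    then show ?case using le_trans \<sigma>(1,3) by blast
  qed
  have "\<exists>n. le k (\<sigma> n)" if k: "k \<in> I" for k
  proof -
    obtain j where j: "j \<in> J" "le k j"
      using J(3) k by blast
    then obtain n where "c n = j"
      using from_nat_into_surj[OF J(2) j(1)] by (auto simp: c_def)
    then show ?thesis
      using le_trans[OF j(2) _ k _ \<sigma>(1)] \<sigma>(4)[of n] c[of n] by blast
  qed
  then show thesis
    using that \<sigma> mono by blast
qed

text \<open>Suppose that \<open>r < F i g\<close>, where \<open>r\<close> bounds all \<open>F k (f k)\<close>. The functionals themselves provide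
  the compact sets: \<open>g\<close> is replaced by a step map with values in a finite set \<open>S\<close>, and along a
  cofinal sequence \<open>\<sigma>\<close> the open sets of the step map are pulled back and shrunk to \<open>V n t\<close> inside
  compact \<open>K n t\<close> inside the preimage of \<open>V (n - 1) t\<close>, in such a way that
  \<open>r < F (\<sigma> n) (step_map S (V n))\<close> persists. For each value \<open>t\<close>, the compact sets \<open>K n t\<close> form a
  projective system over points where \<open>g\<close> exceeds \<open>t\<close>; a thread through them on which all \<open>f k\<close>
  are at most \<open>t\<close> would violate the inequality on the limit. So \<open>f (\<sigma> n)\<close> exceeds \<open>t\<close> on \<open>K n t\<close>
  for some \<open>n\<close>, hence for all later ones. As \<open>S\<close> is finite, one \<open>m\<close> serves all values, and
  \<open>step_map S (V m) \<le> f (\<sigma> m)\<close> gives the contradiction \<open>r < F (\<sigma> m) (f (\<sigma> m)) \<le> r\<close>.\<close>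

lemma cover_property_locally_compact:
  assumes sober: "\<And>i. i \<in> I \<Longrightarrow> sober_space (X i)"
    and lc: "\<And>i. i \<in> I \<Longrightarrow> strongly_locally_compact_space (X i)"
    and countable: "has_countable_cofinal_subset I le"
  shows cover_property
  unfolding cover_property_def
proof (intro allI impI)
  fix F f i g
  assume F: "compatible F" and f: "ascending f" and i: "i \<in> I" and g: "g \<in> lsc_maps (X i)"
    and le: "cone i g \<le> (SUP k\<in>I. cone k (f k))"
  show "F i g \<le> (SUP k\<in>I. F k (f k))"
  proof (rule ccontr)
    define r where "r = (SUP k\<in>I. F k (f k))"
    assume "\<not> F i g \<le> (SUP k\<in>I. F k (f k))"
    then have "r < F i g"
      by (simp add: r_def)
    then obtain S where S: "finite S" "r < F i (step_map S (\<lambda>t. {x. t < g x}))"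
      using approximation_by_finite_step_map[OF compatible_Sup[OF F i] g] by blast
    obtain \<sigma> :: "nat \<Rightarrow> 'i" where \<sigma>: "\<And>n. \<sigma> n \<in> I" and i0: "le i (\<sigma> 0)"
      and \<sigma>_mono: "\<And>m n. m \<le> n \<Longrightarrow> le (\<sigma> m) (\<sigma> n)" and \<sigma>_cofinal: "\<And>k. k \<in> I \<Longrightarrow> \<exists>n. le k (\<sigma> n)"
      by (rule cofinal_sequence[OF countable i]) (rule that)
    \<comment> \<open>A pair \<open>VK\<close> holds the open sets and the compact sets at stage \<open>n\<close>. The last conjunct ties
      the first stage to \<open>g\<close>; later stages are tied to their predecessors.\<close>
    define good where "good n VK \<longleftrightarrow>
        (\<forall>t\<in>S. openin (X (\<sigma> n)) (fst VK t) \<and> compactin (X (\<sigma> n)) (snd VK t) \<and> fst VK t \<subseteq> snd VK t) \<and>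
        r < F (\<sigma> n) (step_map S (fst VK)) \<and>
        (n = 0 \<longrightarrow> (\<forall>t\<in>S. \<forall>y\<in>snd VK t. t < g (p i (\<sigma> 0) y)))"
      for n and VK :: "(ennreal \<Rightarrow> 'a set) \<times> (ennreal \<Rightarrow> 'a set)"
    have "\<exists>VK. \<forall>n. good n (VK n) \<and>
        (\<forall>t\<in>S. \<forall>y\<in>snd (VK (Suc n)) t. p (\<sigma> n) (\<sigma> (Suc n)) y \<in> fst (VK n) t)"
    proof (rule dependent_nat_choice)
      let ?W = "\<lambda>t. {y \<in> topspace (X (\<sigma> 0)). p i (\<sigma> 0) y \<in> {x. t < g x}}"
      have W: "openin (X (\<sigma> 0)) (?W t)" for t
        using lsc_maps_openin[OF g] by (rule openin_preimage[OF i0 i \<sigma>])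
      have "F i (step_map S (\<lambda>t. {x. t < g x})) = F (\<sigma> 0) (step_map S ?W)"
        using compatible_bond[OF F i0 i \<sigma> lsc_maps_step_map[OF lsc_maps_openin[OF g]]]
        by (simp only: lsc_pullback_step_map)
      then have "r < F (\<sigma> 0) (step_map S ?W)"
        using S(2) by simp
      then have "\<exists>V K. (\<forall>t\<in>S. openin (X (\<sigma> 0)) (V t) \<and> compactin (X (\<sigma> 0)) (K t) \<and>
          V t \<subseteq> K t \<and> K t \<subseteq> ?W t) \<and> r < F (\<sigma> 0) (step_map S V)"
        by (intro approximation_by_compacts lc compatible_Sup[OF F] W \<sigma>)
      then obtain V K where "\<forall>t\<in>S. openin (X (\<sigma> 0)) (V t) \<and> compactin (X (\<sigma> 0)) (K t) \<and>
          V t \<subseteq> K t \<and> K t \<subseteq> ?W t" "r < F (\<sigma> 0) (step_map S V)"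
        by (elim exE conjE) (rule that)
      then show "\<exists>VK. good 0 VK"
        by (intro exI[of _ "(V, K)"]) (auto simp: good_def)
    next
      fix VK n assume VK: "good n VK"
      let ?W = "\<lambda>t. {y \<in> topspace (X (\<sigma> (Suc n))). p (\<sigma> n) (\<sigma> (Suc n)) y \<in> fst VK t}"
      have V: "openin (X (\<sigma> n)) (fst VK t)" if "t \<in> S" for t
        using VK that by (simp add: good_def)
      have W: "openin (X (\<sigma> (Suc n))) (?W t)" if "t \<in> S" for t
        using V[OF that] by (intro openin_preimage \<sigma>_mono \<sigma>) auto
      have "F (\<sigma> n) (step_map S (fst VK)) = F (\<sigma> (Suc n)) (step_map S ?W)"
        using compatible_bond[OF F \<sigma>_mono[of n "Suc n"] \<sigma> \<sigma> lsc_maps_step_map[OF V]]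
        by (simp add: lsc_pullback_step_map)
      then have "r < F (\<sigma> (Suc n)) (step_map S ?W)"
        using VK by (simp add: good_def)
      then have "\<exists>V K. (\<forall>t\<in>S. openin (X (\<sigma> (Suc n))) (V t) \<and> compactin (X (\<sigma> (Suc n))) (K t) \<and>
          V t \<subseteq> K t \<and> K t \<subseteq> ?W t) \<and> r < F (\<sigma> (Suc n)) (step_map S V)"
        by (intro approximation_by_compacts lc compatible_Sup[OF F] W \<sigma>)
      then obtain V' K' where "\<forall>t\<in>S. openin (X (\<sigma> (Suc n))) (V' t) \<and>
          compactin (X (\<sigma> (Suc n))) (K' t) \<and> V' t \<subseteq> K' t \<and> K' t \<subseteq> ?W t"
          "r < F (\<sigma> (Suc n)) (step_map S V')"
        by (elim exE conjE) (rule that)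
      then show "\<exists>VK'. good (Suc n) VK' \<and>
          (\<forall>t\<in>S. \<forall>y\<in>snd VK' t. p (\<sigma> n) (\<sigma> (Suc n)) y \<in> fst VK t)"
        by (intro exI[of _ "(V', K')"]) (auto simp: good_def)
    qed
    then obtain VK where VK: "\<And>n. good n (VK n)"
      and VK_Suc: "\<And>n t y. t \<in> S \<Longrightarrow> y \<in> snd (VK (Suc n)) t \<Longrightarrow> p (\<sigma> n) (\<sigma> (Suc n)) y \<in> fst (VK n) t"
      by blast
    define V where "V n = fst (VK n)" for n
    define K where "K n = snd (VK n)" for n
    have V: "openin (X (\<sigma> n)) (V n t)" and VK_sub: "V n t \<subseteq> K n t"
      and K: "compactin (X (\<sigma> n)) (K n t)" if "t \<in> S" for n t
      using VK[of n] that by (auto simp: good_def V_def K_def)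
    have rV: "r < F (\<sigma> n) (step_map S (V n))" for n
      using VK[of n] by (simp add: good_def V_def)
    have K0: "t < g (p i (\<sigma> 0) y)" if "t \<in> S" "y \<in> K 0 t" for t y
      using VK[of 0] that by (simp add: good_def K_def)
    have K_top: "y \<in> topspace (X (\<sigma> n))" if "t \<in> S" "y \<in> K n t" for n t y
      using compactin_subset_topspace[OF K] that by blast
    have K_p: "p (\<sigma> m) (\<sigma> n) y \<in> K m t" if "m \<le> n" "t \<in> S" "y \<in> K n t" for m n t y
      using that
    proof (induction n arbitrary: y rule: dec_induct)
      case base
      then show ?case using p_id[OF \<sigma>] K_top by simp
    next
      case (step n)
      have "p (\<sigma> n) (\<sigma> (Suc n)) y \<in> K n t"
        using VK_Suc[OF step.prems(1), of y n] step.prems VK_sub[OF step.prems(1), of n]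
        by (auto simp: V_def K_def)
      then have "p (\<sigma> m) (\<sigma> n) (p (\<sigma> n) (\<sigma> (Suc n)) y) \<in> K m t"
        using step by blast
      then show ?case
        using p_comp[OF \<sigma>_mono \<sigma>_mono \<sigma> \<sigma> \<sigma> K_top[OF step.prems]] step.hyps by simp
    qed
    have stage: "\<exists>n. \<forall>y\<in>K n t. t < f (\<sigma> n) y" if t: "t \<in> S" for t
    proof -
      \<comment> \<open>The thread lemma wants a compact set at every index: it is pushed forward from the
        sequence. Taking the first admissible term makes \<open>N\<close> monotone, and gives \<open>N i = 0\<close>.\<close>
      define N where "N k = (LEAST n. le k (\<sigma> n))" for k
      have N: "le k (\<sigma> (N k))" if "k \<in> I" for k
        unfolding N_def using \<sigma>_cofinal[OF that] by (rule LeastI_ex)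
      have N_mono: "N k \<le> N l" if "le k l" "k \<in> I" "l \<in> I" for k l
      proof -
        have "le k (\<sigma> (N l))"
          using le_trans[OF that(1) N that(2,3)] \<sigma> that(3) by blast
        then show ?thesis
          unfolding N_def by (rule Least_le)
      qed
      define Q where "Q k = p k (\<sigma> (N k)) ` K (N k) t" for k
      have "\<exists>k\<in>I. Q k \<subseteq> {y. t < f k y}"
      proof (rule ccontr)
        assume no: "\<not> ?thesis"
        obtain z where z: "z \<in> topspace Z" "\<And>k. k \<in> I \<Longrightarrow> z k \<notin> {y. t < f k y}"
            "\<And>k. k \<in> I \<Longrightarrow> \<exists>y\<in>Q k. specializes (X k) y (z k)"
        proof (rule sober_thread_avoiding[where K = I and Q = Q and E = "\<lambda>k. {y. t < f k y}"])
          show "\<exists>k\<in>I. le j k" if "j \<in> I" for j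
            using le_refl that by blast
          show "compactin (X k) (Q k)" if "k \<in> I" for k
            unfolding Q_def using K[OF t] p_continuous[OF N[OF that] that \<sigma>] by (rule image_compactin)
          show "p k l y \<in> Q k" if kl: "k \<in> I" "l \<in> I" "le k l" "y \<in> Q l" for k l y
          proof -
            obtain w where w: "w \<in> K (N l) t" "y = p l (\<sigma> (N l)) w"
              using kl(4) by (auto simp: Q_def)
            have wt: "w \<in> topspace (X (\<sigma> (N l)))"
              using K_top[OF t w(1)] .
            have "p k l y = p k (\<sigma> (N l)) w"
              unfolding w(2) by (rule p_comp[OF kl(3) N[OF kl(2)] kl(1,2) \<sigma> wt])
            also have "\<dots> = p k (\<sigma> (N k)) (p (\<sigma> (N k)) (\<sigma> (N l)) w)"
              by (rule p_comp[OF N[OF kl(1)] \<sigma>_mono[OF N_mono[OF kl(3,1,2)]] kl(1) \<sigma> \<sigma> wt, symmetric])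
            also have "\<dots> \<in> Q k"
              unfolding Q_def using K_p[OF N_mono[OF kl(3,1,2)] t w(1)] by blast
            finally show ?thesis .
          qed
          show "y \<in> {y. t < f l y}"
            if "k \<in> I" "l \<in> I" "le k l" "y \<in> topspace (X l)" "p k l y \<in> {y. t < f k y}" for k l y
            using ascending_leD[OF f that(3,1,2,4)] that(5) by auto
        qed (use sober no lsc_maps_openin[OF ascending_lsc[OF f]] in auto)
        have "N i = 0"
          unfolding N_def using i0 by (rule Least_eq_0)
        then obtain y where y: "y \<in> K 0 t" "specializes (X i) (p i (\<sigma> 0) y) (z i)"
          using z(3)[OF i] by (auto simp: Q_def)
        have "t < g (p i (\<sigma> 0) y)"
          using K0[OF t y(1)] .
        also have "\<dots> \<le> g (z i)"
          by (rule lsc_maps_mono_specializes[OF g y(2)])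
        also have "\<dots> \<le> (SUP k\<in>I. f k (z k))"
          using le_funD[OF le, of z] z(1) by (simp add: lsc_pullback_apply image_image)
        also have "\<dots> \<le> t"
          using z(2) by (intro SUP_least) (simp add: not_less)
        finally show False by simp
      qed
      then obtain k where k: "k \<in> I" "Q k \<subseteq> {y. t < f k y}"
        by blast
      have "t < f (\<sigma> (N k)) y" if y: "y \<in> K (N k) t" for y
      proof -
        have "t < f k (p k (\<sigma> (N k)) y)"
          using k(2) y by (auto simp: Q_def)
        also have "\<dots> \<le> f (\<sigma> (N k)) y"
          by (rule ascending_leD[OF f N[OF k(1)] k(1) \<sigma> K_top[OF t y]])
        finally show ?thesis .
      qed
      then show ?thesis by blast
    qed
    then obtain n where n: "\<And>t y. t \<in> S \<Longrightarrow> y \<in> K (n t) t \<Longrightarrow> t < f (\<sigma> (n t)) y"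
      by metis
    define m where "m = Max (insert 0 (n ` S))"
    have m: "n t \<le> m" if "t \<in> S" for t
      unfolding m_def using S(1) that by (intro Max_ge) auto
    have "step_map S (V m) \<le> f (\<sigma> m)"
      unfolding step_map_le_iff
    proof (intro ballI)
      fix t y assume t: "t \<in> S" and "y \<in> V m t"
      then have y: "y \<in> K m t"
        using VK_sub by blast
      have "t < f (\<sigma> (n t)) (p (\<sigma> (n t)) (\<sigma> m) y)"
        using n[OF t] K_p[OF m[OF t] t y] by blast
      also have "\<dots> \<le> f (\<sigma> m) y"
        by (rule ascending_leD[OF f \<sigma>_mono[OF m[OF t]] \<sigma> \<sigma> K_top[OF t y]])
      finally show "t \<le> f (\<sigma> m) y" by simp
    qed
    then have "F (\<sigma> m) (step_map S (V m)) \<le> F (\<sigma> m) (f (\<sigma> m))"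
      using V by (intro compatible_mono[OF F \<sigma>] lsc_maps_step_map ascending_lsc[OF f \<sigma>])
    also have "\<dots> \<le> r"
      unfolding r_def using \<sigma> by (rule SUP_upper)
    finally show False
      using rV[of m] by simp
  qed
qed

end

theorem corollary14p3:
  fixes I :: "'i set" and le :: "'i \<Rightarrow> 'i \<Rightarrow> bool"
    and X :: "'i \<Rightarrow> 'a topology" and p :: "'i \<Rightarrow> 'i \<Rightarrow> 'a \<Rightarrow> 'a"
    and b :: normalization
  assumes "projective_system I le X p"
    and "ep_system I le X p
      \<or> (has_countable_cofinal_subset I le \<and>
         (\<forall>i\<in>I. strongly_locally_compact_space (X i) \<and> sober_space (X i) \<and>
                (b = Normalized \<longrightarrow> compact_space (X i))))
      \<or> ((\<forall>i\<in>I. sum_consonant_space (X i) \<and> sober_space (X i) \<and>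
                 (b = Normalized \<longrightarrow> compact_space (X i))) \<and>
         (\<forall>i\<in>I. \<forall>j\<in>I. le i j \<longrightarrow> order_proper_map (X j) (X i) (p i j)))"
  shows "projective_system I le (\<lambda>i. ADP b (X i)) (\<lambda>i j. ADP_map (X j) (X i) (p i j))
    \<and> is_projective_limit I le (\<lambda>i. ADP b (X i)) (\<lambda>i j. ADP_map (X j) (X i) (p i j))
        (ADP b (canonical_limit I le X p))
        (\<lambda>i. ADP_map (canonical_limit I le X p) (X i) (\<lambda>x. x i))"
proof -
  interpret projective I le X p
    by (rule projective.intro) (rule assms(1))
  have cover_property
    using assms(2)
  proof (elim disjE)
    assume "ep_system I le X p"
    then show ?thesis by (rule cover_property_ep_system)
  qed (auto intro: cover_property_locally_compact cover_property_order_proper)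
  then show ?thesis
    using projective_system_ADP[OF assms(1)] is_projective_limit_ADP by blast
qed

end
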